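(* Let $P$ be a $2$-simple and $2$-simplicial $4$-polytope with a simplex facet $S$ in bounded position, with the vertices of $S$ labelled $v_0,v_1,v_2,v_3$ in any order. Then $\mathcal I^1(P;S)$ and $\mathcal I^2(P;S)$ are again $2$-simple and $2$-simplicial.
   Context: A polytope is $2$-simplicial if all its $2$-faces are triangles; a $4$-polytope is $2$-simple if every edge lies in exactly $3$ facets. Conventions: for a $4$-polytope $Q\subset\mathbb R^4$ and a facet $F$, $H_F$ is the affine hull of $F$, oriented so that $Q$ lies on its closed positive side; $H_F^+$, $H_F^-$ are the open positive and negative sides. Facets are adjacent if they share a ridge ($2$-face). For a facet $T$ of $Q$ and disjoint sets $\mathcal F,\mathcal N$ of facets adjacent to $T$, $V_T(\mathcal F,\mathcal N;Q)$ is the set of points lying in $H_F^-$ for $F\in\mathcal N\cup\{T\}$, in $H_F$ for $F\in\mathcal F$, and in $H_F^+$ for all other facets $F$ of $Q$. A simplex facet is a facet that is a $3$-simplex; a simplex facet $S$ is in bounded position if the affine hulls of the four facets adjacent to $S$ meet in a point of $H_S^-$. A facet adjacent to a simplex facet $T$ is specified below by the vertex set of the triangle it shares with $T$. Construction $\mathcal I^1$: let $P^{(0)}=P$ and for $i=1,\dots,5$ let $P^{(i)}=\operatorname{conv}(P^{(i-1)}\cup\{v_{3+i}\})$ with $v_{3+i}\in V_{S_i}(\mathcal F_i,\emptyset;P^{(i-1)})$, where: $i=1$: $S_1=S$, $\mathcal F_1$ = facet across $\{v_0,v_1,v_2\}$; $i=2$: $S_2=\operatorname{conv}\{v_0,v_1,v_3,v_4\}$,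 $\mathcal F_2$ = facets across $\{v_1,v_3,v_4\}$ and $\{v_0,v_1,v_3\}$; $i=3$: $S_3=\operatorname{conv}\{v_0,v_2,v_3,v_4\}$, $\mathcal F_3$ = facets across $\{v_0,v_3,v_4\}$ and $\{v_0,v_2,v_3\}$; $i=4$: $S_4=\operatorname{conv}\{v_2,v_3,v_4,v_6\}$, $\mathcal F_4$ = facets across $\{v_2,v_3,v_4\}$ and $\{v_2,v_3,v_6\}$; $i=5$: $S_5=\operatorname{conv}\{v_0,v_2,v_4,v_6\}$, $\mathcal F_5$ = facets across $\{v_0,v_4,v_6\}$, $\{v_2,v_4,v_6\}$, $\{v_0,v_2,v_4\}$. Set $\mathcal I^1(P;S)=P^{(5)}$. Construction $\mathcal I^2$: let $Q^{(0)}=P$ and for $i=1,\dots,4$ let $Q^{(i)}=\operatorname{conv}(Q^{(i-1)}\cup\{v_{3+i}\})$ with $v_{3+i}\in V_{S_i}(\mathcal F_i,\mathcal N_i;Q^{(i-1)})$, where: $i=1$: $S_1=S$, $\mathcal F_1$ = facet across $\{v_0,v_1,v_3\}$, $\mathcal N_1=\emptyset$; $i=2$: $S_2=\operatorname{conv}\{v_1,v_2,v_3,v_4\}$, $\mathcal F_2$ = facets across $\{v_1,v_2,v_4\}$ and $\{v_1,v_2,v_3\}$, $\mathcal N_2=\emptyset$; $i=3$: $S_3=\operatorname{conv}\{v_0,v_2,v_3,v_4\}$, $\mathcal F_3$ = facets across $\{v_0,v_2,v_4\}$ and $\{v_0,v_2,v_3\}$, $\mathcal N_3$ = facet across $\{v_2,v_3,v_4\}$;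 $i=4$: $S_4=\operatorname{conv}\{v_3,v_4,v_5,v_6\}$, $\mathcal F_4$ = facets across $\{v_3,v_4,v_6\}$, $\{v_3,v_4,v_5\}$, $\{v_3,v_5,v_6\}$, $\mathcal N_4=\emptyset$. Set $\mathcal I^2(P;S)=Q^{(4)}$. (In both constructions each $S_i$ is a simplex facet of the previous polytope, the regions are nonempty, and the combinatorial type of the result depends only on $P$, $S$ and the labelling.) *)

theory Defs
  imports "HOL-Analysis.Analysis"
begin

type_synonym pt = "real^4"

definition polytope4 :: "pt set \<Rightarrow> bool" where
  "polytope4 Q \<longleftrightarrow> polytope Q \<and> aff_dim Q = 4"

definition two_simplicial :: "pt set \<Rightarrow> bool" where
  "two_simplicial Q \<longleftrightarrow> (\<forall>F. F face_of Q \<and> aff_dim F = 2 \<longrightarrow> 2 simplex F)"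

definition two_simple :: "pt set \<Rightarrow> bool" where
  "two_simple Q \<longleftrightarrow>
     (\<forall>E. E face_of Q \<and> aff_dim E = 1 \<longrightarrow> card {F. F facet_of Q \<and> E \<subseteq> F} = 3)"

definition pos_side :: "pt set \<Rightarrow> pt set \<Rightarrow> pt \<Rightarrow> bool" where
  "pos_side Q F x \<longleftrightarrow>
     (\<exists>a b. a \<noteq> 0 \<and> affine hull F = {y. a \<bullet> y = b} \<and> Q \<subseteq> {y. a \<bullet> y \<ge> b} \<and> a \<bullet> x > b)"

definition neg_side :: "pt set \<Rightarrow> pt set \<Rightarrow> pt \<Rightarrow> bool" where
  "neg_side Q F x \<longleftrightarrow>
     (\<exists>a b. a \<noteq> 0 \<and> affine hull F = {y. a \<bullet> y = b} \<and> Q \<subseteq> {y. a \<bullet> y \<ge> b} \<and> a \<bullet> x < b)"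

definition adjacent_facets :: "pt set \<Rightarrow> pt set \<Rightarrow> pt set \<Rightarrow> bool" where
  "adjacent_facets Q F G \<longleftrightarrow>
     F facet_of Q \<and> G facet_of Q \<and> F \<noteq> G \<and> aff_dim (F \<inter> G) = 2"

definition across :: "pt set \<Rightarrow> pt set \<Rightarrow> pt set set \<Rightarrow> pt set set" where
  "across Q T As = {G. adjacent_facets Q T G \<and> (\<exists>A\<in>As. T \<inter> G = convex hull A)}"

definition region :: "pt set \<Rightarrow> pt set \<Rightarrow> pt set set \<Rightarrow> pt set set \<Rightarrow> pt set" where
  "region Q T Fs Ns =
     {x. (\<forall>F\<in>insert T Ns. neg_side Q F x) \<and> (\<forall>F\<in>Fs. x \<in> affine hull F) \<and>
         (\<forall>F. F facet_of Q \<and> F \<notin> insert T (Fs \<union> Ns) \<longrightarrow> pos_side Q F x)}"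

definition simplex_facet :: "pt set \<Rightarrow> pt set \<Rightarrow> bool" where
  "simplex_facet Q S \<longleftrightarrow> S facet_of Q \<and> 3 simplex S"

definition bounded_position :: "pt set \<Rightarrow> pt set \<Rightarrow> bool" where
  "bounded_position Q S \<longleftrightarrow> simplex_facet Q S \<and>
     (\<exists>p. \<Inter>{affine hull G | G. adjacent_facets Q S G} = {p} \<and> neg_side Q S p)"

definition I1_valid :: "pt set \<Rightarrow> pt \<Rightarrow> pt \<Rightarrow> pt \<Rightarrow> pt \<Rightarrow> pt \<Rightarrow> pt \<Rightarrow> pt \<Rightarrow> pt \<Rightarrow> pt \<Rightarrow> bool" where
  "I1_valid P v0 v1 v2 v3 v4 v5 v6 v7 v8 \<longleftrightarrow>
    (let S1 = convex hull {v0, v1, v2, v3};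
         P1 = convex hull (insert v4 P);
         S2 = convex hull {v0, v1, v3, v4};
         P2 = convex hull (insert v5 P1);
         S3 = convex hull {v0, v2, v3, v4};
         P3 = convex hull (insert v6 P2);
         S4 = convex hull {v2, v3, v4, v6};
         P4 = convex hull (insert v7 P3);
         S5 = convex hull {v0, v2, v4, v6}
     in v4 \<in> region P S1 (across P S1 {{v0, v1, v2}}) {} \<and>
        v5 \<in> region P1 S2 (across P1 S2 {{v1, v3, v4}, {v0, v1, v3}}) {} \<and>
        v6 \<in> region P2 S3 (across P2 S3 {{v0, v3, v4}, {v0, v2, v3}}) {} \<and>
        v7 \<in> region P3 S4 (across P3 S4 {{v2, v3, v4}, {v2, v3, v6}}) {} \<and>
        v8 \<in> region P4 S5 (across P4 S5 {{v0, v4, v6}, {v2, v4, v6}, {v0, v2, v4}}) {})"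

definition I1 :: "pt set \<Rightarrow> pt \<Rightarrow> pt \<Rightarrow> pt \<Rightarrow> pt \<Rightarrow> pt \<Rightarrow> pt set" where
  "I1 P v4 v5 v6 v7 v8 =
     convex hull (insert v8 (convex hull (insert v7 (convex hull (insert v6
       (convex hull (insert v5 (convex hull (insert v4 P)))))))))"

definition I2_valid :: "pt set \<Rightarrow> pt \<Rightarrow> pt \<Rightarrow> pt \<Rightarrow> pt \<Rightarrow> pt \<Rightarrow> pt \<Rightarrow> pt \<Rightarrow> pt \<Rightarrow> bool" where
  "I2_valid P v0 v1 v2 v3 v4 v5 v6 v7 \<longleftrightarrow>
    (let S1 = convex hull {v0, v1, v2, v3};
         Q1 = convex hull (insert v4 P);
         S2 = convex hull {v1, v2, v3, v4};
         Q2 = convex hull (insert v5 Q1);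
         S3 = convex hull {v0, v2, v3, v4};
         Q3 = convex hull (insert v6 Q2);
         S4 = convex hull {v3, v4, v5, v6}
     in v4 \<in> region P S1 (across P S1 {{v0, v1, v3}}) {} \<and>
        v5 \<in> region Q1 S2 (across Q1 S2 {{v1, v2, v4}, {v1, v2, v3}}) {} \<and>
        v6 \<in> region Q2 S3 (across Q2 S3 {{v0, v2, v4}, {v0, v2, v3}})
                            (across Q2 S3 {{v2, v3, v4}}) \<and>
        v7 \<in> region Q3 S4 (across Q3 S4 {{v3, v4, v6}, {v3, v4, v5}, {v3, v5, v6}}) {})"

definition I2 :: "pt set \<Rightarrow> pt \<Rightarrow> pt \<Rightarrow> pt \<Rightarrow> pt \<Rightarrow> pt set" where
  "I2 P v4 v5 v6 v7 =
     convex hull (insert v7 (convex hull (insert v6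
       (convex hull (insert v5 (convex hull (insert v4 P)))))))"

end

theory Submission
  imports Defs
begin

text \<open>
  Call the number of facets through an edge its degree. Placing \<open>v\<close> beyond a simplex facet \<open>T\<close>, on
  the hyperplanes of some neighbours of \<open>T\<close> and beneath all other facets, produces only new edges of
  degree 3, changes the degree of an edge of \<open>T\<close> by 1 minus the number of those neighbours through
  it, and fixes all other degrees. A 2-face that is not a triangle can only arise from two adjacent
  facets whose hyperplanes both contain \<open>v\<close>; such facets together with \<open>T\<close> would be all the facets
  through the edge they share with \<open>T\<close>, which is impossible if that edge has degree 4. In both
  constructions the edges of degree 4 are always exactly three (none at the end), and every edge of
  \<open>T\<close> lying in two of the chosen neighbours is one of them. The step of the second construction that
  has two facets on the far side follows the same count; it destroys one edge.
\<close>

section \<open>Facet inequalities\<close>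

text \<open>The degree formula is a balance of ridges. An edge E of the simplex T lies in two ridges
  of T, one for each neighbour of T through E. Adding v deletes T. A ridge towards an unchosen
  neighbour becomes the base of a new facet, while a chosen neighbour is only extended. With k
  chosen neighbours through E the change is therefore -1 + (2 - k). This determines how the list of
  degree 4 edges evolves. One chosen neighbour raises the three edges of T at the vertex it omits.
  Two chosen neighbours lower the edge of T that they share and raise the opposite edge of T. Three
  chosen neighbours lower the three edges of T at their common vertex. The two requirements pull
  against each other: lowering a degree needs two chosen neighbours at the same edge, which is the
  very situation in which a 2-face could grow beyond a triangle. Degree 4 on exactly that edge
  reconciles them, so the list of such edges has to be carried through every step as part of the
  invariant. Everything about the new polytope is read off from the signs at v of the facet
  inequalities of the old one; no coordinates enter.\<close>

definition facet_slack :: "pt set \<Rightarrow> pt set \<Rightarrow> pt \<Rightarrow> real" where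
  "facet_slack Q F = (SOME f. \<exists>a b. a \<noteq> 0 \<and> affine hull F = {y. a \<bullet> y = b} \<and>
      Q \<subseteq> {y. a \<bullet> y \<ge> b} \<and> f = (\<lambda>x. a \<bullet> x - b))"

lemma polytope4_polyhedron: "polytope4 Q \<Longrightarrow> polyhedron Q"
  by (simp add: polytope4_def polytope_imp_polyhedron)

lemma polytope4_convex: "polytope4 Q \<Longrightarrow> convex Q"
  by (simp add: polytope4_def polytope_imp_convex)

lemma polytope4_facet_iff:
  "polytope4 Q \<Longrightarrow> F facet_of Q \<longleftrightarrow> F face_of Q \<and> aff_dim F = 3"
  by (auto simp: polytope4_def facet_of_def)

text \<open>Faces of a polyhedron are exposed, and a hyperplane of 4-space containing a
  3-dimensional face has the dimension of the affine hull of that face, hence equals it.\<close>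

lemma facet_hyperplane_exists:
  assumes Q: "polytope4 Q" and F: "F facet_of Q"
  shows "\<exists>a b. a \<noteq> 0 \<and> affine hull F = {y. a \<bullet> y = b} \<and> Q \<subseteq> {y. a \<bullet> y \<ge> b}"
proof -
  have "F exposed_face_of Q"
    using assms exposed_face_of_polyhedron facet_of_imp_face_of polytope4_polyhedron by blast
  then obtain a b where ab: "Q \<subseteq> {x. a \<bullet> x \<le> b}" "F = Q \<inter> {x. a \<bullet> x = b}"
    by (auto simp: exposed_face_of_def)
  have "a \<noteq> 0"
  proof
    assume "a = 0"
    then have "F = Q \<or> F = {}" using ab by auto
    then show False using F by (auto simp: facet_of_def)
  qed
  have "affine hull F \<subseteq> {y. a \<bullet> y = b}"
    by (rule hull_minimal) (use ab affine_hyperplane in auto)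
  moreover have "aff_dim (affine hull F) = aff_dim {y. a \<bullet> y = b}"
    using assms \<open>a \<noteq> 0\<close> by (simp add: polytope4_facet_iff)
  moreover have "affine hull F \<noteq> {}"
    using F by (simp add: facet_of_def)
  ultimately have "affine hull F = {y. a \<bullet> y = b}"
    by (intro affine_dim_equal) (auto simp: affine_hyperplane)
  then have "-a \<noteq> 0 \<and> affine hull F = {y. (-a) \<bullet> y = -b} \<and> Q \<subseteq> {y. (-a) \<bullet> y \<ge> -b}"
    using \<open>a \<noteq> 0\<close> ab by auto
  then show ?thesis by blast
qed

text \<open>The functional picked by \<open>SOME\<close> is determined only up to a positive factor,
  so later arguments rely only on its sign, its zero set and its being affine.\<close>

lemma facet_slack_repr:
  assumes "polytope4 Q" "F facet_of Q"
  obtains a b where "a \<noteq> 0" "affine hull F = {y. a \<bullet> y = b}" "Q \<subseteq> {y. a \<bullet> y \<ge> b}"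
    "facet_slack Q F = (\<lambda>x. a \<bullet> x - b)"
proof -
  have "\<exists>f. \<exists>a b. a \<noteq> 0 \<and> affine hull F = {y. a \<bullet> y = b} \<and>
      Q \<subseteq> {y. a \<bullet> y \<ge> b} \<and> f = (\<lambda>x. a \<bullet> x - b)"
    using facet_hyperplane_exists[OF assms] by blast
  from someI_ex[OF this] show ?thesis
    unfolding facet_slack_def[symmetric] using that by blast
qed

lemma affine_hull_facet_iff:
  "polytope4 Q \<Longrightarrow> F facet_of Q \<Longrightarrow> x \<in> affine hull F \<longleftrightarrow> facet_slack Q F x = 0"
  by (erule (1) facet_slack_repr) auto

lemma facet_slack_nonneg:
  "polytope4 Q \<Longrightarrow> F facet_of Q \<Longrightarrow> x \<in> Q \<Longrightarrow> facet_slack Q F x \<ge> 0"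
  by (erule (1) facet_slack_repr) auto

lemma in_facet_iff:
  assumes "polytope4 Q" "F facet_of Q"
  shows "x \<in> F \<longleftrightarrow> x \<in> Q \<and> facet_slack Q F x = 0"
  using face_of_imp_eq_affine_Int[of Q F] affine_hull_facet_iff[OF assms] assms
    polytope4_convex facet_of_imp_face_of by blast

lemma facet_slack_affine:
  assumes "polytope4 Q" "F facet_of Q" "u + t = 1"
  shows "facet_slack Q F (u *\<^sub>R x + t *\<^sub>R y) = u * facet_slack Q F x + t * facet_slack Q F y"
proof -
  obtain a b where "facet_slack Q F = (\<lambda>x. a \<bullet> x - b)"
    using facet_slack_repr assms by metis
  moreover have "b = (u + t) * b" using assms by simp
  ultimately show ?thesis
    by (simp add: algebra_simps)
qed

lemma facet_slack_translate:
  assumes "polytope4 Q" "F facet_of Q"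
  shows "facet_slack Q F (x + t *\<^sub>R (y - z)) =
    facet_slack Q F x + t * (facet_slack Q F y - facet_slack Q F z)"
proof -
  obtain a b where "facet_slack Q F = (\<lambda>x. a \<bullet> x - b)"
    using facet_slack_repr assms by metis
  then show ?thesis
    by (simp add: algebra_simps)
qed

lemma facet_exists_outside:
  assumes "polytope4 Q" "F facet_of Q"
  obtains q where "q \<in> Q" "facet_slack Q F q > 0"
proof -
  have "\<exists>q\<in>Q. q \<notin> F"
    using assms by (metis facet_of_imp_subset facet_of_irrefl subsetI subset_antisym)
  then show ?thesis
    using in_facet_iff[OF assms] facet_slack_nonneg[OF assms] that by force
qed

text \<open>Both representations of the hyperplane are positive at a point \<open>q\<close> of \<open>Q\<close> off the facet; if their
  signs at \<open>x\<close> differed, only one of them would vanish somewhere between \<open>q\<close> and \<open>x\<close>.\<close>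

lemma facet_slack_same_sign:
  assumes Q: "polytope4 Q" "F facet_of Q" and "affine hull F = {y. a \<bullet> y = b}"
    and "Q \<subseteq> {y. a \<bullet> y \<ge> b}" and "(a \<bullet> x - b) * facet_slack Q F x < 0"
  shows False
proof -
  let ?f = "facet_slack Q F" and ?g = "\<lambda>x. a \<bullet> x - b"
  have z: "?f y = 0 \<longleftrightarrow> ?g y = 0" for y
    using affine_hull_facet_iff[OF Q, of y] assms(3) by auto
  obtain q where q: "q \<in> Q" "?f q > 0"
    using facet_exists_outside[OF Q] .
  then have gq: "?g q > 0" using assms(4) z[of q] by force
  have cross: False if "h x < 0" "h q > 0" "k x > 0" "k q > 0"
    "\<And>u t. u + t = 1 \<Longrightarrow> h (u *\<^sub>R x + t *\<^sub>R q) = u * h x + t * h q"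
    "\<And>u t. u + t = 1 \<Longrightarrow> k (u *\<^sub>R x + t *\<^sub>R q) = u * k x + t * k q"
    "\<And>y. h y = 0 \<longleftrightarrow> k y = 0" for h k :: "pt \<Rightarrow> real"
  proof -
    \<comment> \<open>The parameter at which the affine function \<open>h\<close> vanishes between
      \<open>x\<close> and \<open>q\<close>; the function \<open>k\<close> is still positive at that
      point.\<close>
    define u where "u = h q / (h q - h x)"
    have u: "0 < u" "u < 1" "1 - u > 0" using that by (auto simp: u_def field_simps)
    have "u * h x + (1 - u) * h q = 0"
    proof -
      have "u * (h q - h x) = h q" using that by (simp add: u_def)
      then show ?thesis by (simp add: algebra_simps)
    qed
    then have "k (u *\<^sub>R x + (1 - u) *\<^sub>R q) = 0"
      using that(5)[of u "1 - u"] that(7) by simp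
    then have "u * k x + (1 - u) * k q = 0"
      using that(6)[of u "1 - u"] by simp
    moreover have "u * k x > 0" "(1 - u) * k q > 0" using u that by auto
    ultimately show False by linarith
  qed
  have g: "?g (u *\<^sub>R x + t *\<^sub>R q) = u * ?g x + t * ?g q" if "u + t = 1" for u t
  proof -
    have "b = (u + t) * b" using that by simp
    then show ?thesis by (simp add: algebra_simps)
  qed
  have f: "?f (u *\<^sub>R x + t *\<^sub>R q) = u * ?f x + t * ?f q" if "u + t = 1" for u t
    using facet_slack_affine[OF Q that] .
  show False
  proof (cases "?f x > 0")
    case True
    then have "?g x < 0" using assms(5) by (simp add: mult_less_0_iff)
    then show False using cross[of ?g ?f] True gq q f g z by blast
  next
    case False
    then have "?f x < 0" "?g x > 0" using assms(5) by (auto simp: mult_less_0_iff)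
    then show False using cross[of ?f ?g] gq q f g z by blast
  qed
qed

lemma pos_side_slack:
  assumes "polytope4 Q" "F facet_of Q" "pos_side Q F x"
  shows "facet_slack Q F x > 0"
proof -
  obtain a b where ab: "affine hull F = {y. a \<bullet> y = b}" "Q \<subseteq> {y. a \<bullet> y \<ge> b}" "a \<bullet> x > b"
    using assms(3) by (auto simp: pos_side_def)
  then have "facet_slack Q F x \<noteq> 0"
    using affine_hull_facet_iff[OF assms(1,2), of x] by auto
  moreover have "\<not> facet_slack Q F x < 0"
    using facet_slack_same_sign[OF assms(1,2) ab(1,2), of x] ab(3) by (auto simp: mult_less_0_iff)
  ultimately show ?thesis by simp
qed

lemma neg_side_slack:
  assumes "polytope4 Q" "F facet_of Q" "neg_side Q F x"
  shows "facet_slack Q F x < 0"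
proof -
  obtain a b where ab: "affine hull F = {y. a \<bullet> y = b}" "Q \<subseteq> {y. a \<bullet> y \<ge> b}" "a \<bullet> x < b"
    using assms(3) by (auto simp: neg_side_def)
  then have "facet_slack Q F x \<noteq> 0"
    using affine_hull_facet_iff[OF assms(1,2), of x] by auto
  moreover have "\<not> facet_slack Q F x > 0"
    using facet_slack_same_sign[OF assms(1,2) ab(1,2), of x] ab(3) by (auto simp: mult_less_0_iff)
  ultimately show ?thesis by simp
qed

lemma finite_facets: "polytope4 Q \<Longrightarrow> finite {F. F facet_of Q}"
  by (simp add: polytope4_def finite_polytope_facets)

text \<open>A segment from an interior point to a point outside leaves \<open>Q\<close> inside some
  facet. The slack of that facet is positive at the start and zero at the exit, so it is negative at
  the end.\<close>

lemma polytope4_facet_inequalities: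
  assumes Q: "polytope4 Q"
  shows "x \<in> Q \<longleftrightarrow> (\<forall>F. F facet_of Q \<longrightarrow> facet_slack Q F x \<ge> 0)"
proof
  show "x \<in> Q \<Longrightarrow> \<forall>F. F facet_of Q \<longrightarrow> facet_slack Q F x \<ge> 0"
    using facet_slack_nonneg[OF Q] by blast
next
  assume x: "\<forall>F. F facet_of Q \<longrightarrow> facet_slack Q F x \<ge> 0"
  show "x \<in> Q"
  proof (rule ccontr)
    assume "x \<notin> Q"
    have cl: "closed Q" using Q by (simp add: polytope4_def polytope_imp_closed)
    have dim: "aff_dim Q = 4" using Q by (simp add: polytope4_def)
    then have "Q \<noteq> {}" by auto
    then have ne: "interior Q \<noteq> {}"
      using polytope4_convex[OF Q] dim
      by (simp add: interior_rel_interior_gen rel_interior_eq_empty)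
    then obtain q where q: "q \<in> interior Q" by blast
    have "closed_segment q x \<inter> frontier Q \<noteq> {}"
      using q \<open>x \<notin> Q\<close> interior_subset
      by (intro connected_Int_frontier) auto
    then obtain z where z: "z \<in> closed_segment q x" "z \<in> frontier Q" by blast
    have "rel_frontier Q = frontier Q"
      using ne rel_frontier_nonempty_interior by blast
    then obtain F where F: "F facet_of Q" "z \<in> F"
      using rel_frontier_of_polyhedron[OF polytope4_polyhedron[OF Q]] z by blast
    obtain u where u: "0 \<le> u" "u \<le> 1" "z = (1 - u) *\<^sub>R q + u *\<^sub>R x"
      using z(1) by (auto simp: in_segment)
    have "q \<notin> F"
      using F(1) q face_of_disjoint_interior[of F Q] facet_of_imp_face_of facet_of_irrefl by blast
    then have fq: "facet_slack Q F q > 0"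
      using in_facet_iff[OF Q F(1)] facet_slack_nonneg[OF Q F(1)] q interior_subset by (metis less_eq_real_def subsetD)
    have fz: "(1 - u) * facet_slack Q F q + u * facet_slack Q F x = 0"
      using facet_slack_affine[OF Q F(1), of "1 - u" u q x] in_facet_iff[OF Q F(1), of z] F u by simp
    have "u \<noteq> 1"
    proof
      assume "u = 1"
      then have "z = x" using u by simp
      then show False using \<open>x \<notin> Q\<close> F facet_of_imp_subset by blast
    qed
    then have "(1 - u) * facet_slack Q F q > 0" using u fq by simp
    moreover have "u * facet_slack Q F x \<ge> 0" using u x F by simp
    ultimately show False using fz by linarith
  qed
qed

text \<open>A short move from \<open>k\<close> is restricted only by the facets through
  \<open>k\<close>: the other slacks are positive there and stay so, and there are finitely many of
  them. The factor \<open>s\<close> lets one statement cover moving towards \<open>v\<close> and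
  away from it.\<close>

lemma move_towards_in_polytope4:
  assumes Q: "polytope4 Q" and k: "k \<in> Q"
    and pos: "\<And>F. F facet_of Q \<Longrightarrow> k \<in> F \<Longrightarrow> s * (facet_slack Q F v) \<ge> 0"
  obtains t where "t > 0" "k + (t * s) *\<^sub>R (v - k) \<in> Q"
proof -
  let ?f = "facet_slack Q"
  have "\<forall>\<^sub>F t in at_right 0. \<forall>F\<in>{F. F facet_of Q}. ?f F (k + (t * s) *\<^sub>R (v - k)) \<ge> 0"
  proof (rule eventually_ball_finite[OF finite_facets[OF Q]], clarify)
    fix F assume F: "F facet_of Q"
    have eq: "?f F (k + (t * s) *\<^sub>R (v - k)) = ?f F k + (t * s) * (?f F v - ?f F k)" for t
      by (rule facet_slack_translate[OF Q F])
    show "\<forall>\<^sub>F t in at_right 0. ?f F (k + (t * s) *\<^sub>R (v - k)) \<ge> 0"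
    proof (cases "k \<in> F")
      case True
      then have z: "?f F k = 0" using in_facet_iff[OF Q F] by simp
      have "\<forall>\<^sub>F t::real in at_right 0. t > 0" by (simp add: eventually_at_right_less)
      then show ?thesis
      proof eventually_elim
        case (elim t)
        then have "t * (s * ?f F v) \<ge> 0" using pos[OF F True] by simp
        then show ?case unfolding eq z by (simp add: mult.assoc)
      qed
    next
      case False
      then have p: "?f F k > 0"
        using in_facet_iff[OF Q F] facet_slack_nonneg[OF Q F k] k by force
      have "((\<lambda>t. ?f F k + (t * s) * (?f F v - ?f F k)) \<longlongrightarrow> ?f F k + (0 * s) * (?f F v - ?f F k)) (at_right 0)"
        by (intro tendsto_intros)
      then have "\<forall>\<^sub>F t in at_right 0. ?f F k + (t * s) * (?f F v - ?f F k) > 0"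
        using p by (intro order_tendstoD(1)) auto
      then show ?thesis unfolding eq by eventually_elim simp
    qed
  qed
  moreover have "\<forall>\<^sub>F t::real in at_right 0. t > 0" by (simp add: eventually_at_right_less)
  ultimately have "\<forall>\<^sub>F t in at_right 0. t > 0 \<and> k + (t * s) *\<^sub>R (v - k) \<in> Q"
    by eventually_elim (auto simp: polytope4_facet_inequalities[OF Q])
  then have "\<exists>t. t > 0 \<and> k + (t * s) *\<^sub>R (v - k) \<in> Q"
    using eventually_happens'[OF trivial_limit_at_right_real] by blast
  then show ?thesis using that by blast
qed

section \<open>Ridges and edges of a 4-polytope\<close>

lemma facet_subset_imp_eq:
  assumes Q: "polytope4 Q" and "F facet_of Q" "G facet_of Q" "F \<subseteq> G"
  shows "F = G"
proof (rule ccontr)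
  assume "F \<noteq> G"
  have "F face_of G"
    using assms face_of_face facet_of_imp_face_of by blast
  then have "aff_dim F < aff_dim G"
    using \<open>F \<noteq> G\<close> assms by (intro face_of_aff_dim_lt) (auto intro: face_of_imp_convex facet_of_imp_face_of)
  then show False using assms by (simp add: polytope4_facet_iff)
qed

lemma facet_point_outside:
  assumes Q: "polytope4 Q" and "F facet_of Q" "G facet_of Q" "F \<noteq> G"
  obtains p where "p \<in> F" "p \<in> Q" "facet_slack Q F p = 0" "facet_slack Q G p > 0"
proof -
  obtain p where "p \<in> F" "p \<notin> G"
    using facet_subset_imp_eq[OF Q] assms by blast
  moreover have "p \<in> Q" "facet_slack Q F p = 0"
    using in_facet_iff[OF Q assms(2)] \<open>p \<in> F\<close> by auto
  moreover have "facet_slack Q G p \<noteq> 0"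
    using in_facet_iff[OF Q assms(3)] \<open>p \<notin> G\<close> \<open>p \<in> Q\<close> by auto
  ultimately show ?thesis
    using that facet_slack_nonneg[OF Q assms(3), of p] by force
qed

text \<open>A point of \<open>Q\<close> is, modulo the affine hull of \<open>K\<close>, a nonnegative combination of the directions
  \<open>p i - k\<close>; hence the slack of \<open>G\<close> would vanish identically if \<open>G\<close> were none of the \<open>F i\<close>.\<close>

lemma facets_of_simplicial_cone:
  fixes F :: "'i \<Rightarrow> pt set" and p :: "'i \<Rightarrow> pt"
  assumes Q: "polytope4 Q" and I: "finite I" and F: "\<And>i. i \<in> I \<Longrightarrow> F i facet_of Q"
    and k: "k \<in> K" and KF: "\<And>i. i \<in> I \<Longrightarrow> K \<subseteq> F i"
    and p: "\<And>i. i \<in> I \<Longrightarrow> p i \<in> Q" "\<And>i. i \<in> I \<Longrightarrow> facet_slack Q (F i) (p i) > 0"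
      "\<And>i j. i \<in> I \<Longrightarrow> j \<in> I \<Longrightarrow> i \<noteq> j \<Longrightarrow> facet_slack Q (F j) (p i) = 0"
    and hull: "\<And>w. (\<And>i. i \<in> I \<Longrightarrow> facet_slack Q (F i) w = 0) \<Longrightarrow> w \<in> affine hull K"
    and G: "G facet_of Q" "K \<subseteq> G"
  shows "G \<in> F ` I"
proof (rule ccontr)
  assume nG: "G \<notin> F ` I"
  let ?f = "facet_slack Q"
  \<comment> \<open>These are the coordinates dual to the \<open>F i\<close>: subtracting the
    corresponding combination of the directions \<open>p i - k\<close> makes every slack of an
    \<open>F i\<close> vanish, so what remains lies in \<open>affine hull K\<close>.\<close>
  define c where "c i q = ?f (F i) q / ?f (F i) (p i)" for i q
  have lin: "?f H (q - (\<Sum>i\<in>I. c i q *\<^sub>R (p i - k))) = ?f H q - (\<Sum>i\<in>I. c i q * ?f H (p i))"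
    if H: "H facet_of Q" "k \<in> H" for H q
  proof -
    obtain a b where f: "?f H = (\<lambda>x. a \<bullet> x - b)"
      using facet_slack_repr[OF Q H(1)] by metis
    have "a \<bullet> k = b"
      using in_facet_iff[OF Q H(1), of k] H(2) f by simp
    then show ?thesis
      by (simp add: f inner_diff_right inner_sum_right)
  qed
  have G_comb: "?f G q = (\<Sum>i\<in>I. c i q * ?f G (p i))" for q
  proof -
    let ?w = "q - (\<Sum>i\<in>I. c i q *\<^sub>R (p i - k))"
    have "?w \<in> affine hull K"
    proof (rule hull)
      fix j assume j: "j \<in> I"
      have "(\<Sum>i\<in>I. c i q * ?f (F j) (p i)) = (\<Sum>i\<in>I. if i = j then c j q * ?f (F j) (p j) else 0)"
        using p(3) j by (intro sum.cong) auto
      also have "\<dots> = c j q * ?f (F j) (p j)" using I j by simp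
      also have "\<dots> = ?f (F j) q" using p(2)[OF j] by (simp add: c_def)
      finally show "?f (F j) ?w = 0"
        using lin[of "F j" q] F[OF j] KF[OF j] k by auto
    qed
    then have "?w \<in> affine hull G" using G(2) hull_mono by blast
    then have "?f G ?w = 0" using affine_hull_facet_iff[OF Q G(1)] by blast
    then show ?thesis using lin[of G q] G k by auto
  qed
  have c0: "c i q \<ge> 0" if "i \<in> I" "q \<in> Q" for i q
    using facet_slack_nonneg[OF Q F[OF that(1)] that(2)] p(2)[OF that(1)] by (simp add: c_def)
  \<comment> \<open>At a point \<open>q\<close> of \<open>G\<close> off \<open>F i\<close> the
    combination is a vanishing sum of nonnegative terms, and the coefficient of index
    \<open>i\<close> is positive, so \<open>p i\<close> must lie in \<open>G\<close>.\<close>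
  have zero: "?f G (p i) = 0" if i: "i \<in> I" for i
  proof -
    have "G \<noteq> F i" using nG i by blast
    then obtain q where q: "q \<in> Q" "?f G q = 0" "?f (F i) q > 0"
      using facet_point_outside[OF Q G(1) F[OF i]] by blast
    have "c j q * ?f G (p j) \<ge> 0" if "j \<in> I" for j
      using c0[OF that q(1)] facet_slack_nonneg[OF Q G(1) p(1)[OF that]] by simp
    moreover have "(\<Sum>j\<in>I. c j q * ?f G (p j)) = 0" using G_comb[of q] q(2) by simp
    ultimately have "\<forall>j\<in>I. c j q * ?f G (p j) = 0"
      using sum_nonneg_eq_0_iff[OF I, of "\<lambda>j. c j q * ?f G (p j)"] by blast
    then have "c i q * ?f G (p i) = 0" using i by blast
    moreover have "c i q > 0" using q(3) p(2)[OF i] by (simp add: c_def)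
    ultimately show ?thesis by simp
  qed
  obtain q where "q \<in> Q" "?f G q > 0" using facet_exists_outside[OF Q G(1)] .
  then show False using G_comb[of q] zero by simp
qed

lemma aff_dim_affine_psubset:
  fixes S T :: "'a::euclidean_space set"
  assumes "affine S" "affine T" "S \<subseteq> T" "p \<in> T" "p \<notin> S"
  shows "aff_dim S < aff_dim T"
proof -
  have "aff_dim S \<noteq> aff_dim T"
  proof
    assume eq: "aff_dim S = aff_dim T"
    then have "S \<noteq> {}" using assms(4) aff_dim_empty by (metis empty_iff)
    then show False using affine_dim_equal[OF assms(1,2) _ assms(3) eq] assms(4,5) by blast
  qed
  then show ?thesis using aff_dim_subset[OF assms(3)] by simp
qed

text \<open>A proper face is the intersection of the facets containing it, so dimension 2 needs at
  least two of them. Two distinct facet hyperplanes meet in a plane, which is then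
  \<open>affine hull K\<close>, and the cone argument with two generators excludes a third
  facet.\<close>

lemma ridge_facets:
  assumes Q: "polytope4 Q" and K: "K face_of Q" "aff_dim K = 2"
  obtains G H where "adjacent_facets Q G H" "G \<inter> H = K"
    "{F. F facet_of Q \<and> K \<subseteq> F} = {G, H}"
proof -
  let ?f = "facet_slack Q"
  have ne: "K \<noteq> {}" "K \<noteq> Q" using K Q by (auto simp: polytope4_def)
  have Int: "\<Inter>{F. F facet_of Q \<and> K \<subseteq> F} = K"
    using face_of_polyhedron[OF polytope4_polyhedron[OF Q] K(1) ne] by (rule sym)
  obtain G where G: "G facet_of Q" "K \<subseteq> G"
    using face_of_polyhedron_subset_facet[OF polytope4_polyhedron[OF Q] K(1) ne] .
  have "\<exists>H. H facet_of Q \<and> K \<subseteq> H \<and> H \<noteq> G"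
  proof (rule ccontr)
    assume "\<not> ?thesis"
    then have "G \<subseteq> \<Inter>{F. F facet_of Q \<and> K \<subseteq> F}" by blast
    then have "K = G" unfolding Int using G(2) by (rule subset_antisym[rotated])
    then show False using G(1) K(2) Q by (simp add: polytope4_facet_iff)
  qed
  then obtain H where H: "H facet_of Q" "K \<subseteq> H" "H \<noteq> G" by blast
  obtain p where p: "p \<in> Q" "?f G p = 0" "?f H p > 0"
    using facet_point_outside[OF Q G(1) H(1)] H(3) by blast
  obtain q where q: "q \<in> Q" "?f H q = 0" "?f G q > 0"
    using facet_point_outside[OF Q H(1) G(1)] H(3) by blast
  have "aff_dim (affine hull G \<inter> affine hull H) < aff_dim (affine hull G)"
    using p affine_hull_facet_iff[OF Q G(1), of p] affine_hull_facet_iff[OF Q H(1), of p]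
    by (intro aff_dim_affine_psubset[of _ _ p]) (auto simp: affine_Int)
  then have "aff_dim (affine hull G \<inter> affine hull H) \<le> 2"
    using G Q by (simp add: polytope4_facet_iff)
  moreover have sub: "affine hull K \<subseteq> affine hull G \<inter> affine hull H"
    using G H by (simp add: hull_mono)
  ultimately have "aff_dim (affine hull K) = aff_dim (affine hull G \<inter> affine hull H)"
    using aff_dim_subset[OF sub] K by simp
  then have hull: "affine hull K = affine hull G \<inter> affine hull H"
    using sub ne by (intro affine_dim_equal) (auto simp: affine_Int)
  obtain k where k: "k \<in> K" using ne by blast
  have only: "F = G \<or> F = H" if F: "F facet_of Q" "K \<subseteq> F" for F
  proof -
    \<comment> \<open>The generator dual to \<open>G\<close> is \<open>q\<close>, which lies in
      \<open>H\<close> but off \<open>G\<close>; the one dual to \<open>H\<close> is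
      \<open>p\<close>.\<close>
    have "F \<in> (\<lambda>x. x) ` {G, H}"
    proof (rule facets_of_simplicial_cone[OF Q _ _ k, where p="\<lambda>x. if x = G then q else p"])
      show "w \<in> affine hull K" if "\<And>i. i \<in> {G, H} \<Longrightarrow> ?f i w = 0" for w
        using that[of G] that[of H] affine_hull_facet_iff[OF Q G(1), of w]
          affine_hull_facet_iff[OF Q H(1), of w] unfolding hull by simp
      show "?f i (if i = G then q else p) > 0" if "i \<in> {G, H}" for i
        using that p(3) q(3) H(3) by auto
      show "?f j (if i = G then q else p) = 0" if "i \<in> {G, H}" "j \<in> {G, H}" "i \<noteq> j" for i j
        using that p(2) q(2) H(3) by auto
      show "(if i = G then q else p) \<in> Q" for i
        using p(1) q(1) by simp
    qed (use G(1,2) H(1,2) F in auto)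
    then show ?thesis by auto
  qed
  then have eq: "{F. F facet_of Q \<and> K \<subseteq> F} = {G, H}" using G H by blast
  moreover have "G \<inter> H = K" using Int unfolding eq by simp
  moreover have "adjacent_facets Q G H"
    using G H \<open>G \<inter> H = K\<close> K by (auto simp: adjacent_facets_def)
  ultimately show ?thesis using that by blast
qed

lemma adjacent_facetsD:
  assumes "adjacent_facets Q G H"
  shows "G facet_of Q" "H facet_of Q" "G \<noteq> H" "(G \<inter> H) face_of Q" "aff_dim (G \<inter> H) = 2"
  using assms by (auto simp: adjacent_facets_def intro: face_of_Int facet_of_imp_face_of)

lemma adjacent_facets_only:
  assumes Q: "polytope4 Q" and GH: "adjacent_facets Q G H" and F: "F facet_of Q" "G \<inter> H \<subseteq> F"
  shows "F = G \<or> F = H"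
proof -
  note d = adjacent_facetsD[OF GH]
  obtain G' H' where eq: "{F. F facet_of Q \<and> G \<inter> H \<subseteq> F} = {G', H'}"
    using ridge_facets[OF Q d(4,5)] by metis
  then have "F \<in> {G', H'}" "G \<in> {G', H'}" "H \<in> {G', H'}"
    using d F by blast+
  then show ?thesis using d(3) by auto
qed

text \<open>\<open>K\<close> lies in a facet of \<open>Q\<close> and, being of smaller dimension, in
  a facet of that facet. The latter is a ridge, hence the intersection of two adjacent
  facets.\<close>

lemma face_in_adjacent_facets:
  assumes Q: "polytope4 Q" and K: "K face_of Q" "K \<noteq> {}" "aff_dim K \<le> 2"
  obtains G H where "adjacent_facets Q G H" "K \<subseteq> G \<inter> H"
proof -
  have "K \<noteq> Q" using K Q by (auto simp: polytope4_def)
  then obtain F where F: "F facet_of Q" "K \<subseteq> F"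
    using face_of_polyhedron_subset_facet[OF polytope4_polyhedron[OF Q] K(1,2)] by blast
  have dF: "aff_dim F = 3" using F Q by (simp add: polytope4_facet_iff)
  have "polyhedron F"
    using F polytope4_polyhedron[OF Q] face_of_polyhedron_polyhedron facet_of_imp_face_of by blast
  moreover have "K face_of F"
    using F K face_of_face facet_of_imp_face_of by blast
  moreover have "K \<noteq> F" using K dF by auto
  ultimately obtain R where R: "R facet_of F" "K \<subseteq> R"
    using face_of_polyhedron_subset_facet K(2) by blast
  then have "R face_of Q" "aff_dim R = 2"
    using F dF by (auto simp: facet_of_def intro: face_of_trans)
  then show ?thesis
    using ridge_facets[OF Q, of R] R(2) that by metis
qed

definition facet_degree :: "pt set \<Rightarrow> pt set \<Rightarrow> nat" where
  "facet_degree Q E = card {F. F facet_of Q \<and> E \<subseteq> F}"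

text \<open>Since a ridge lies in only two facets, each two of the \<open>F\<close>s share a point
  off the third. These three points make the hyperplanes independent, so they meet in the line
  spanned by \<open>E\<close>, and they generate \<open>Q\<close> modulo that line; no fourth facet
  fits. The lemma serves to contradict degree 4.\<close>

lemma three_adjacent_facets_degree:
  assumes Q: "polytope4 Q" and E: "aff_dim E = 1" "E \<subseteq> F1" "E \<subseteq> F2" "E \<subseteq> F3"
    and adj: "adjacent_facets Q F1 F2" "adjacent_facets Q F2 F3" "adjacent_facets Q F1 F3"
  shows "facet_degree Q E = 3"
proof -
  let ?f = "facet_slack Q"
  note d12 = adjacent_facetsD[OF adj(1)] and d23 = adjacent_facetsD[OF adj(2)]
    and d13 = adjacent_facetsD[OF adj(3)]
  have pt: "\<exists>p\<in>Q. ?f F p = 0 \<and> ?f G p = 0 \<and> ?f H p > 0"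
    if H: "adjacent_facets Q F G" "H facet_of Q" "H \<noteq> F" "H \<noteq> G" for F G H
  proof -
    note d = adjacent_facetsD[OF H(1)]
    obtain p where "p \<in> F \<inter> G" "p \<notin> H"
      using adjacent_facets_only[OF Q H(1,2)] H(3,4) by blast
    then show ?thesis
      using in_facet_iff[OF Q d(1)] in_facet_iff[OF Q d(2)] in_facet_iff[OF Q H(2)]
        facet_slack_nonneg[OF Q H(2)] by force
  qed
  obtain p1 where p1: "p1 \<in> Q" "?f F2 p1 = 0" "?f F3 p1 = 0" "?f F1 p1 > 0"
    using pt[OF adj(2) d12(1)] d12 d13 by auto
  obtain p2 where p2: "p2 \<in> Q" "?f F1 p2 = 0" "?f F3 p2 = 0" "?f F2 p2 > 0"
    using pt[OF adj(3) d12(2)] d12 d23 by auto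
  obtain p3 where p3: "p3 \<in> Q" "?f F1 p3 = 0" "?f F2 p3 = 0" "?f F3 p3 > 0"
    using pt[OF adj(1) d13(2)] d13 d23 by auto
  note aff = affine_hull_facet_iff[OF Q d12(1)] affine_hull_facet_iff[OF Q d12(2)]
    affine_hull_facet_iff[OF Q d13(2)]
  let ?L = "affine hull F1 \<inter> affine hull F2 \<inter> affine hull F3"
  have "aff_dim (affine hull F1 \<inter> affine hull F2) < aff_dim (affine hull F1)"
    using p2 aff by (intro aff_dim_affine_psubset[of _ _ p2]) (auto simp: affine_Int)
  moreover have "aff_dim ?L < aff_dim (affine hull F1 \<inter> affine hull F2)"
    using p3 aff by (intro aff_dim_affine_psubset[of _ _ p3]) (auto simp: affine_Int)
  ultimately have "aff_dim ?L \<le> 1"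
    using d12(1) Q by (simp add: polytope4_facet_iff)
  moreover have sub: "affine hull E \<subseteq> ?L"
    using E by (simp add: hull_mono)
  ultimately have "aff_dim (affine hull E) = aff_dim ?L"
    using aff_dim_subset[OF sub] E by simp
  moreover have neE: "E \<noteq> {}" using E by auto
  ultimately have hull: "affine hull E = ?L"
    using sub by (intro affine_dim_equal) (auto simp: affine_Int)
  obtain k where k: "k \<in> E" using neE by blast
  have only: "F \<in> {F1, F2, F3}" if F: "F facet_of Q" "E \<subseteq> F" for F
  proof -
    let ?p = "\<lambda>x. if x = F1 then p1 else if x = F2 then p2 else p3"
    have "F \<in> (\<lambda>x. x) ` {F1, F2, F3}"
    proof (rule facets_of_simplicial_cone[OF Q _ _ k, where p="?p"])
      show "w \<in> affine hull E" if "\<And>i. i \<in> {F1, F2, F3} \<Longrightarrow> ?f i w = 0" for w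
        using that[of F1] that[of F2] that[of F3] unfolding hull by (simp add: aff)
      show "?f i (?p i) > 0" if "i \<in> {F1, F2, F3}" for i
        using that p1(4) p2(4) p3(4) d12(3) d13(3) d23(3) by auto
      show "?f j (?p i) = 0" if "i \<in> {F1, F2, F3}" "j \<in> {F1, F2, F3}" "i \<noteq> j" for i j
        using that p1(2,3) p2(2,3) p3(2,3) d12(3) d13(3) d23(3) by auto
      show "?p i \<in> Q" for i
        using p1(1) p2(1) p3(1) by simp
    qed (use E(2-4) F d12(1,2) d13(2) in auto)
    then show ?thesis by auto
  qed
  then have "{F. F facet_of Q \<and> E \<subseteq> F} = {F1, F2, F3}" using E d12 d13 by blast
  then show ?thesis using d12(3) d13(3) d23(3) by (simp add: facet_degree_def)
qed

section \<open>Adding a point to a 4-polytope\<close>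

lemma hull_insert_decompose:
  assumes "convex Q" "Q \<noteq> {}" "x \<in> convex hull (insert v Q)"
  obtains u t q where "0 \<le> u" "0 \<le> t" "u + t = 1" "q \<in> Q" "x = u *\<^sub>R v + t *\<^sub>R q"
proof -
  have "convex hull Q = Q" using assms(1) by (rule hull_same)
  then show ?thesis using assms(3) that unfolding convex_hull_insert[OF assms(2)] by auto
qed

text \<open>A point of \<open>G\<close> strictly between \<open>v\<close> and a point
  \<open>q\<close> of \<open>Q\<close> forces both ends into the face \<open>G\<close>. So
  \<open>G\<close> is either a face of \<open>Q\<close> or the cone with apex \<open>v\<close> over
  its trace on \<open>Q\<close>.\<close>

lemma hull_insert_face_cases:
  assumes Q: "convex Q" "Q \<noteq> {}" and G: "G face_of (convex hull (insert v Q))"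
  shows "(G \<inter> Q) face_of Q"
    and "v \<notin> G \<Longrightarrow> G \<subseteq> Q"
    and "v \<in> G \<Longrightarrow> convex hull (insert v (G \<inter> Q)) = G"
proof -
  let ?Q = "convex hull (insert v Q)"
  have sub: "Q \<subseteq> ?Q" "v \<in> ?Q" by (auto simp: hull_inc)
  have "(G \<inter> Q) face_of (?Q \<inter> Q)" by (rule face_of_slice[OF G Q(1)])
  then show "(G \<inter> Q) face_of Q" using sub by (simp add: Int_absorb1)
  have dec: "x = v \<or> x \<in> Q \<or> (\<exists>q\<in>Q. v \<in> G \<and> q \<in> G \<and> x \<in> closed_segment v q)" if "x \<in> G" for x
  proof -
    have "x \<in> ?Q" using that G face_of_imp_subset by blast
    then obtain u t q where *: "0 \<le> u" "0 \<le> t" "u + t = 1" "q \<in> Q" "x = u *\<^sub>R v + t *\<^sub>R q"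
      by (rule hull_insert_decompose[OF Q])
    have seg: "x \<in> closed_segment v q"
      using * by (auto simp: in_segment intro!: exI[of _ t])
    show ?thesis
    proof (cases "x = v \<or> x = q")
      case True
      then show ?thesis using * by auto
    next
      case False
      then have "x \<in> open_segment v q" using seg by (simp add: open_segment_def)
      then have "v \<in> G \<and> q \<in> G" using face_ofD[OF G] sub * that by blast
      then show ?thesis using * seg by blast
    qed
  qed
  show "G \<subseteq> Q" if "v \<notin> G" using dec that by blast
  show "convex hull (insert v (G \<inter> Q)) = G" if v: "v \<in> G"
  proof
    show "G \<subseteq> convex hull (insert v (G \<inter> Q))"
    proof
      fix x assume x: "x \<in> G"
      from dec[OF x] consider "x = v" | "x \<in> Q" | q where "q \<in> Q" "q \<in> G" "x \<in> closed_segment v q"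
        by blast
      then show "x \<in> convex hull (insert v (G \<inter> Q))"
      proof cases
        case (3 q)
        then have "convex hull {v, q} \<subseteq> convex hull (insert v (G \<inter> Q))"
          by (intro hull_mono) auto
        then show ?thesis using 3 by (auto simp: segment_convex_hull)
      qed (use x in \<open>auto intro: hull_inc\<close>)
    qed
    show "convex hull (insert v (G \<inter> Q)) \<subseteq> G"
      using v G face_of_imp_convex by (intro hull_minimal) auto
  qed
qed

lemma polytope4_hull_insert:
  assumes "polytope4 Q"
  shows "polytope4 (convex hull (insert v Q))"
proof -
  obtain V where V: "finite V" "Q = convex hull V"
    using assms by (auto simp: polytope4_def polytope_def)
  then have "convex hull (insert v Q) = convex hull (insert v V)"
    by (metis hull_insert)
  then have "polytope (convex hull (insert v Q))"
    using V by (simp add: polytope_convex_hull)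
  moreover have "aff_dim Q \<le> aff_dim (convex hull (insert v Q))"
    by (intro aff_dim_subset) (auto intro: hull_inc)
  moreover have "aff_dim (convex hull (insert v Q)) \<le> 4"
    using aff_dim_le_DIM[of "convex hull (insert v Q)"] by simp
  ultimately show ?thesis using assms by (simp add: polytope4_def)
qed

lemma polytope4_nonempty: "polytope4 Q \<Longrightarrow> Q \<noteq> {}"
  by (auto simp: polytope4_def)

lemma exposed_face_hull_insert:
  assumes "Q \<subseteq> {x. b \<le> a \<bullet> x}" "b \<le> a \<bullet> v"
  shows "(convex hull (insert v Q) \<inter> {x. a \<bullet> x = b}) face_of (convex hull (insert v Q))"
proof -
  have "convex hull (insert v Q) \<subseteq> {x. b \<le> a \<bullet> x}"
    using assms by (intro hull_minimal convex_halfspace_ge) auto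
  then show ?thesis
    by (intro face_of_Int_supporting_hyperplane_ge) auto
qed

text \<open>A ridge next to a facet whose hyperplane contains \<open>v\<close> is deliberately left
  out: there the facet itself is extended by \<open>v\<close>, and no new facet is built on the
  ridge.\<close>

definition horizon :: "pt set \<Rightarrow> pt \<Rightarrow> pt set set" where
  "horizon Q v = {G \<inter> H | G H. adjacent_facets Q G H \<and> facet_slack Q G v > 0 \<and> facet_slack Q H v < 0}"

definition on_facets :: "pt set \<Rightarrow> pt \<Rightarrow> pt set set" where
  "on_facets Q v = {F. F facet_of Q \<and> facet_slack Q F v = 0}"

text \<open>The cone stays in the hyperplane of \<open>F\<close>, which meets \<open>Q\<close> only
  in \<open>F\<close>. Together with its analogue for the horizon this recovers the base of a cone
  from the cone, so different bases give different facets.\<close>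

lemma hull_insert_on_Int:
  assumes Q: "polytope4 Q" and F: "F \<in> on_facets Q v"
  shows "convex hull (insert v F) \<inter> Q = F"
proof
  have f: "F facet_of Q" "facet_slack Q F v = 0" using F by (auto simp: on_facets_def)
  then have "v \<in> affine hull F" using affine_hull_facet_iff[OF Q] by blast
  then have "convex hull (insert v F) \<subseteq> affine hull F"
    by (intro hull_minimal) (auto simp: hull_inc affine_imp_convex)
  then show "convex hull (insert v F) \<inter> Q \<subseteq> F"
    using affine_hull_facet_iff[OF Q f(1)] in_facet_iff[OF Q f(1)] by blast
  show "F \<subseteq> convex hull (insert v F) \<inter> Q"
    using f facet_of_imp_subset by (auto intro: hull_inc)
qed

text \<open>The facet \<open>H\<close> vanishes on \<open>R\<close> and is negative at
  \<open>v\<close>, so it is negative at every point of the cone off \<open>R\<close> and keeps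
  these points out of \<open>Q\<close>.\<close>

lemma hull_insert_horizon_Int:
  assumes Q: "polytope4 Q" and R: "R \<in> horizon Q v"
  shows "convex hull (insert v R) \<inter> Q = R"
proof
  obtain G H where GH: "R = G \<inter> H" "adjacent_facets Q G H" "facet_slack Q H v < 0"
    using R by (auto simp: horizon_def)
  note d = adjacent_facetsD[OF GH(2)]
  show "R \<subseteq> convex hull (insert v R) \<inter> Q"
    using GH d(4) face_of_imp_subset by (auto intro: hull_inc)
  show "convex hull (insert v R) \<inter> Q \<subseteq> R"
  proof
    fix z assume z: "z \<in> convex hull (insert v R) \<inter> Q"
    have "convex R" "R \<noteq> {}" using d GH by (auto intro: face_of_imp_convex)
    then obtain u t r where *: "0 \<le> u" "0 \<le> t" "u + t = 1" "r \<in> R" "z = u *\<^sub>R v + t *\<^sub>R r"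
      using hull_insert_decompose z by blast
    have "facet_slack Q H r = 0" using * GH in_facet_iff[OF Q d(2)] by blast
    then have "u * facet_slack Q H v \<ge> 0"
      using facet_slack_nonneg[OF Q d(2), of z] z facet_slack_affine[OF Q d(2) *(3), of v r] * by simp
    then have "u = 0" using GH(3) *(1) by (auto simp: zero_le_mult_iff)
    then show "z \<in> R" using * by simp
  qed
qed

text \<open>If every facet through \<open>k\<close> lets us move from \<open>k\<close> towards (or away from) \<open>v\<close> inside \<open>Q\<close>, we
  move along the face \<open>G\<close>.\<close>

lemma hull_insert_face_direction:
  assumes Q: "polytope4 Q" and G: "G face_of (convex hull (insert v Q))" "v \<in> G" and k: "k \<in> G \<inter> Q"
    and s: "s \<noteq> 0" "\<And>F. F facet_of Q \<Longrightarrow> k \<in> F \<Longrightarrow> s * facet_slack Q F v \<ge> 0"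
  shows "v \<in> affine hull (G \<inter> Q)"
proof -
  let ?Q = "convex hull (insert v Q)"
  obtain t where t: "t > 0" "k + (t * s) *\<^sub>R (v - k) \<in> Q"
    using move_towards_in_polytope4[OF Q _ s(2)] k by blast
  let ?z = "k + (t * s) *\<^sub>R (v - k)"
  have ts: "t * s \<noteq> 0" using t s by simp
  have aff: "x + c *\<^sub>R (y - x) \<in> affine hull S" if "x \<in> affine hull S" "y \<in> affine hull S"
    for x y :: pt and S c
  proof -
    have "(1 - c) *\<^sub>R x + c *\<^sub>R y \<in> affine hull S"
      using that by (intro mem_affine[OF affine_affine_hull]) auto
    then show ?thesis by (simp add: algebra_simps)
  qed
  have "k \<in> affine hull G" "v \<in> affine hull G" using k G(2) by (auto intro: hull_inc)
  \<comment> \<open>\<open>?z\<close> lies on the line through \<open>k\<close> and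
    \<open>v\<close>, hence in \<open>affine hull G\<close>, and also in \<open>Q\<close>; so it
    belongs to \<open>G \<inter> Q\<close>. Extrapolating from \<open>k\<close> through
    \<open>?z\<close> returns \<open>v\<close>.\<close>
  then have "?z \<in> affine hull G" by (rule aff)
  moreover have "?z \<in> ?Q" using t(2) by (auto intro: hull_inc)
  moreover have "G = affine hull G \<inter> ?Q"
    by (rule face_of_imp_eq_affine_Int[OF convex_convex_hull G(1)])
  ultimately have "?z \<in> G \<inter> Q" using t(2) by blast
  then have "?z \<in> affine hull (G \<inter> Q)" "k \<in> affine hull (G \<inter> Q)"
    using k by (auto intro: hull_inc)
  from this(2,1) have "k + (1 / (t * s)) *\<^sub>R (?z - k) \<in> affine hull (G \<inter> Q)"
    by (rule aff)
  moreover have "k + (1 / (t * s)) *\<^sub>R (?z - k) = v"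
    using ts by simp
  ultimately show ?thesis by simp
qed

text \<open>This is the beneath-beyond description of facets, in a form that allows \<open>v\<close>
  on facet hyperplanes. Facets through \<open>v\<close> are cones over their traces on
  \<open>Q\<close>; conversely each listed set gets an explicit supporting hyperplane.\<close>

lemma facet_of_hull_insert_iff:
  assumes Q: "polytope4 Q" and v: "v \<notin> Q"
  shows "F facet_of (convex hull (insert v Q)) \<longleftrightarrow>
     F facet_of Q \<and> facet_slack Q F v > 0 \<or>
     (\<exists>K \<in> on_facets Q v \<union> horizon Q v. F = convex hull (insert v K))"
    (is "?L \<longleftrightarrow> ?A \<or> ?B")
proof
  let ?Q = "convex hull (insert v Q)"
  note cQ = polytope4_convex[OF Q] and nQ = polytope4_nonempty[OF Q]
  have Q': "polytope4 ?Q" by (rule polytope4_hull_insert[OF Q])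
  have sub: "Q \<subseteq> ?Q" "v \<in> ?Q" by (auto simp: hull_inc)
  assume F: ?L
  then have Ff: "F face_of ?Q" "aff_dim F = 3" using Q' by (auto simp: polytope4_facet_iff)
  note fc = hull_insert_face_cases[OF cQ nQ Ff(1)]
  show "?A \<or> ?B"
  proof (cases "v \<in> F")
    case False
    then have "F \<inter> Q = F" using fc(2) by blast
    then have FQ: "F facet_of Q" using fc(1) Ff(2) Q by (simp add: polytope4_facet_iff)
    obtain a b where ab: "a \<noteq> 0" "affine hull F = {y. a \<bullet> y = b}" "?Q \<subseteq> {y. a \<bullet> y \<ge> b}"
      "facet_slack ?Q F = (\<lambda>x. a \<bullet> x - b)"
      using facet_slack_repr[OF Q' F] .
    have "a \<bullet> v - b \<noteq> 0"
      using in_facet_iff[OF Q' F, of v] False sub ab by simp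
    then have "a \<bullet> v > b" using ab(3) sub(2) by force
    then have "pos_side Q F v" using ab sub unfolding pos_side_def by blast
    then show ?thesis using pos_side_slack[OF Q FQ] FQ by blast
  next
    case True
    let ?K = "F \<inter> Q"
    have eq: "convex hull (insert v ?K) = F" by (rule fc(3)[OF True])
    \<comment> \<open>A cone of dimension 3 has as base either a facet whose hyperplane contains
      \<open>v\<close> or a ridge whose affine hull misses \<open>v\<close>.\<close>
    have "aff_dim (insert v ?K) = 3" using eq Ff(2) by (metis aff_dim_convex_hull)
    then have dim: "aff_dim ?K = (if v \<in> affine hull ?K then 3 else 2)"
      by (simp add: aff_dim_insert split: if_splits)
    show ?thesis
    proof (cases "v \<in> affine hull ?K")
      case on: True
      then have K: "?K facet_of Q" using dim fc(1) Q by (simp add: polytope4_facet_iff)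
      then have "?K \<in> on_facets Q v"
        using on affine_hull_facet_iff[OF Q K] by (simp add: on_facets_def)
      then show ?thesis using eq by blast
    next
      case off: False
      then have dim2: "aff_dim ?K = 2" using dim by simp
      obtain G H where GH: "adjacent_facets Q G H" "G \<inter> H = ?K"
        "{F. F facet_of Q \<and> ?K \<subseteq> F} = {G, H}"
        using ridge_facets[OF Q fc(1) dim2] .
      have cK: "convex ?K" "?K \<noteq> {}" using fc(1) dim2 face_of_imp_convex by auto
      \<comment> \<open>A facet through a relative interior point of \<open>?K\<close> contains all
        of \<open>?K\<close>, so only \<open>G\<close> and \<open>H\<close> restrict a short move
        from \<open>k\<close>.\<close>
      then obtain k where k: "k \<in> rel_interior ?K"
        using rel_interior_eq_empty by blast
      then have kK: "k \<in> F \<inter> Q" using rel_interior_subset by blast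
      have only: "F' = G \<or> F' = H" if "F' facet_of Q" "k \<in> F'" for F'
      proof -
        have "?K \<subseteq> F'"
          using subset_of_face_of[OF facet_of_imp_face_of[OF that(1)], of ?K] k that by blast
        then show ?thesis using GH(3) that by blast
      qed
      \<comment> \<open>If the two slacks at \<open>v\<close> agreed weakly in sign, a short move
        from \<open>k\<close> towards \<open>v\<close> or away from it would stay in
        \<open>Q\<close> and put \<open>v\<close> into \<open>affine hull ?K\<close>.\<close>
      have nn: "\<not> (s * facet_slack Q G v \<ge> 0 \<and> s * facet_slack Q H v \<ge> 0)" if "s \<noteq> 0" for s
        using hull_insert_face_direction[OF Q Ff(1) True kK that] only off by blast
      have "facet_slack Q G v > 0 \<and> facet_slack Q H v < 0 \<or> facet_slack Q G v < 0 \<and> facet_slack Q H v > 0"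
        using nn[of 1] nn[of "-1"] by auto
      moreover have "adjacent_facets Q H G" using GH(1) by (auto simp: adjacent_facets_def Int_commute)
      ultimately have "?K \<in> horizon Q v"
        using GH(1,2) unfolding horizon_def by blast
      then show ?thesis using eq by blast
    qed
  qed
next
  let ?Q = "convex hull (insert v Q)"
  note cQ = polytope4_convex[OF Q] and nQ = polytope4_nonempty[OF Q]
  have Q': "polytope4 ?Q" by (rule polytope4_hull_insert[OF Q])
  have sub: "Q \<subseteq> ?Q" "v \<in> ?Q" by (auto simp: hull_inc)
  assume "?A \<or> ?B"
  then consider "?A" | K where "K \<in> on_facets Q v" "F = convex hull (insert v K)"
    | K where "K \<in> horizon Q v" "F = convex hull (insert v K)" by blast
  then show ?L
  proof cases
    case 1
    then obtain a b where ab: "a \<noteq> 0" "affine hull F = {y. a \<bullet> y = b}" "Q \<subseteq> {y. a \<bullet> y \<ge> b}"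
      "facet_slack Q F = (\<lambda>x. a \<bullet> x - b)"
      using facet_slack_repr[OF Q] by metis
    let ?G = "?Q \<inter> {x. a \<bullet> x = b}"
    have face: "?G face_of ?Q" using exposed_face_hull_insert[OF ab(3)] 1 ab by simp
    have "v \<notin> ?G" using 1 ab by auto
    then have "?G \<subseteq> Q" using hull_insert_face_cases(2)[OF cQ nQ face] by blast
    then have "?G = F" using in_facet_iff[OF Q] ab sub 1 by auto
    then show ?thesis using face 1 Q Q' by (simp add: polytope4_facet_iff)
  next
    case (2 K)
    then have K: "K facet_of Q" "facet_slack Q K v = 0" by (auto simp: on_facets_def)
    then obtain a b where ab: "a \<noteq> 0" "affine hull K = {y. a \<bullet> y = b}" "Q \<subseteq> {y. a \<bullet> y \<ge> b}"
      "facet_slack Q K = (\<lambda>x. a \<bullet> x - b)"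
      using facet_slack_repr[OF Q] by metis
    let ?G = "?Q \<inter> {x. a \<bullet> x = b}"
    have face: "?G face_of ?Q" using exposed_face_hull_insert[OF ab(3)] K ab by simp
    have "v \<in> ?G" using K ab sub by auto
    then have "convex hull (insert v (?G \<inter> Q)) = ?G" using hull_insert_face_cases(3)[OF cQ nQ face] by blast
    moreover have "?G \<inter> Q = K" using in_facet_iff[OF Q K(1)] ab sub by auto
    ultimately have "?G = F" using 2(2) by simp
    moreover have "v \<in> affine hull K" using affine_hull_facet_iff[OF Q K(1)] K(2) by blast
    then have "aff_dim (insert v K) = 3"
      using K(1) Q by (simp add: aff_dim_insert polytope4_facet_iff)
    then have "aff_dim F = 3" using 2(2) by (simp add: aff_dim_convex_hull)
    ultimately show ?thesis using face Q' by (simp add: polytope4_facet_iff)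
  next
    case (3 K)
    then obtain G H where GH: "K = G \<inter> H" "adjacent_facets Q G H" "facet_slack Q G v > 0" "facet_slack Q H v < 0"
      by (auto simp: horizon_def)
    note d = adjacent_facetsD[OF GH(2)]
    obtain a1 b1 where ab1: "facet_slack Q G = (\<lambda>x. a1 \<bullet> x - b1)"
      using facet_slack_repr[OF Q d(1)] by metis
    obtain a2 b2 where ab2: "facet_slack Q H = (\<lambda>x. a2 \<bullet> x - b2)"
      using facet_slack_repr[OF Q d(2)] by metis
    \<comment> \<open>Positive weights for which the combined inequality vanishes at
      \<open>v\<close>. Its hyperplane supports \<open>Q\<close> exactly in
      \<open>G \<inter> H\<close>.\<close>
    define \<alpha> \<beta> where "\<alpha> = - facet_slack Q H v" and "\<beta> = facet_slack Q G v"
    have pos: "\<alpha> > 0" "\<beta> > 0" using GH by (auto simp: \<alpha>_def \<beta>_def)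
    define a b where "a = \<alpha> *\<^sub>R a1 + \<beta> *\<^sub>R a2" and "b = \<alpha> * b1 + \<beta> * b2"
    have f: "a \<bullet> x - b = \<alpha> * facet_slack Q G x + \<beta> * facet_slack Q H x" for x
      by (simp add: a_def b_def ab1 ab2 algebra_simps)
    have fQ: "0 \<le> a \<bullet> x - b" "a \<bullet> x - b = 0 \<longleftrightarrow> x \<in> K" if "x \<in> Q" for x
    proof -
      have nn: "facet_slack Q G x \<ge> 0" "facet_slack Q H x \<ge> 0"
        using facet_slack_nonneg[OF Q] d that by auto
      then have m: "\<alpha> * facet_slack Q G x \<ge> 0" "\<beta> * facet_slack Q H x \<ge> 0"
        using pos by auto
      then show "0 \<le> a \<bullet> x - b" unfolding f by linarith
      have "a \<bullet> x - b = 0 \<longleftrightarrow> \<alpha> * facet_slack Q G x = 0 \<and> \<beta> * facet_slack Q H x = 0"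
        unfolding f using m by linarith
      then show "a \<bullet> x - b = 0 \<longleftrightarrow> x \<in> K"
        using pos in_facet_iff[OF Q d(1), of x] in_facet_iff[OF Q d(2), of x] that GH(1) by auto
    qed
    have fv: "a \<bullet> v - b = 0" unfolding f \<alpha>_def \<beta>_def by simp
    let ?G = "?Q \<inter> {x. a \<bullet> x = b}"
    have face: "?G face_of ?Q" using exposed_face_hull_insert[of Q b a v] fQ fv by auto
    have "v \<in> ?G" using fv sub by auto
    then have "convex hull (insert v (?G \<inter> Q)) = ?G" using hull_insert_face_cases(3)[OF cQ nQ face] by blast
    moreover have "?G \<inter> Q = K"
      using fQ(2) sub GH(1) facet_of_imp_subset[OF d(1)] by auto
    ultimately have "?G = F" using 3(2) by simp
    moreover have "v \<notin> affine hull K"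
      using affine_hull_facet_iff[OF Q d(1), of v] GH hull_mono[of K G affine] by auto
    then have "aff_dim (insert v K) = 3"
      using d(5) GH(1) by (simp add: aff_dim_insert)
    then have "aff_dim F = 3" using 3(2) by (simp add: aff_dim_convex_hull)
    ultimately show ?thesis using face Q' by (simp add: polytope4_facet_iff)
  qed
qed

section \<open>Facet counts along old edges and along segments to the new point\<close>

lemma finite_horizon:
  assumes "polytope4 Q"
  shows "finite (horizon Q v)"
proof (rule finite_subset)
  show "horizon Q v \<subseteq> {K. K face_of Q}"
    using adjacent_facetsD(4) by (auto simp: horizon_def)
  show "finite {K. K face_of Q}"
    using assms finite_polytope_faces by (auto simp: polytope4_def)
qed

lemma finite_on_facets: "polytope4 Q \<Longrightarrow> finite (on_facets Q v)"
  by (rule finite_subset[OF _ finite_facets[of Q]]) (auto simp: on_facets_def)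

lemma on_facets_horizon_disjoint:
  assumes "polytope4 Q" shows "on_facets Q v \<inter> horizon Q v = {}"
proof -
  have "aff_dim K = 3" if "K \<in> on_facets Q v" for K
    using that assms by (simp add: on_facets_def polytope4_facet_iff)
  moreover have "aff_dim K = 2" if "K \<in> horizon Q v" for K
    using that adjacent_facetsD(5) by (auto simp: horizon_def)
  ultimately have "K \<notin> horizon Q v" if "K \<in> on_facets Q v" for K using that by fastforce
  then show ?thesis by blast
qed

lemma card_hull_insert_cones:
  assumes Q: "polytope4 Q"
  shows "card ((\<lambda>K. convex hull (insert v K)) ` {K \<in> on_facets Q v \<union> horizon Q v. E \<subseteq> K}) =
    card {K \<in> on_facets Q v. E \<subseteq> K} + card {K \<in> horizon Q v. E \<subseteq> K}"
proof -
  let ?M = "on_facets Q v \<union> horizon Q v"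
  have Int: "convex hull (insert v K) \<inter> Q = K" if "K \<in> ?M" for K
    using that hull_insert_on_Int[OF Q] hull_insert_horizon_Int[OF Q] by blast
  have "inj_on (\<lambda>K. convex hull (insert v K)) {K \<in> ?M. E \<subseteq> K}"
  proof (rule inj_onI)
    fix K L assume KL: "K \<in> {K \<in> ?M. E \<subseteq> K}" "L \<in> {K \<in> ?M. E \<subseteq> K}"
      "convex hull (insert v K) = convex hull (insert v L)"
    then have "K = convex hull (insert v K) \<inter> Q" "L = convex hull (insert v L) \<inter> Q"
      using Int by blast+
    then show "K = L" using KL(3) by simp
  qed
  then have "card ((\<lambda>K. convex hull (insert v K)) ` {K \<in> ?M. E \<subseteq> K}) = card {K \<in> ?M. E \<subseteq> K}"
    by (rule card_image)
  moreover have "card {K \<in> ?M. E \<subseteq> K} = card ({K \<in> on_facets Q v. E \<subseteq> K} \<union> {K \<in> horizon Q v. E \<subseteq> K})"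
    by (rule arg_cong[of _ _ card]) blast
  moreover have "card ({K \<in> on_facets Q v. E \<subseteq> K} \<union> {K \<in> horizon Q v. E \<subseteq> K}) =
      card {K \<in> on_facets Q v. E \<subseteq> K} + card {K \<in> horizon Q v. E \<subseteq> K}"
    using on_facets_horizon_disjoint[OF Q, of v] finite_on_facets[OF Q, of v] finite_horizon[OF Q, of v]
    by (intro card_Un_disjoint) auto
  ultimately show ?thesis by linarith
qed

text \<open>Facets with positive slack at \<open>v\<close> survive, those with slack zero are
  extended, negative ones disappear, and horizon ridges contribute new cones. The lost facets stand
  on the left to avoid subtraction of naturals.\<close>

lemma facet_degree_hull_insert_old:
  assumes Q: "polytope4 Q" and v: "v \<notin> Q" and E: "E \<subseteq> Q"
  shows "facet_degree (convex hull (insert v Q)) E + card {F. F facet_of Q \<and> facet_slack Q F v < 0 \<and> E \<subseteq> F}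
    = facet_degree Q E + card {R \<in> horizon Q v. E \<subseteq> R}"
proof -
  let ?M = "on_facets Q v \<union> horizon Q v"
  let ?cone = "\<lambda>K. convex hull (insert v K)"
  let ?pos = "{F. F facet_of Q \<and> facet_slack Q F v > 0 \<and> E \<subseteq> F}"
  let ?neg = "{F. F facet_of Q \<and> facet_slack Q F v < 0 \<and> E \<subseteq> F}"
  let ?on = "{K \<in> on_facets Q v. E \<subseteq> K}"
  have Int: "?cone K \<inter> Q = K" if "K \<in> ?M" for K
    using that hull_insert_on_Int[OF Q] hull_insert_horizon_Int[OF Q] by blast
  have E_iff: "E \<subseteq> ?cone K \<longleftrightarrow> E \<subseteq> K" if "K \<in> ?M" for K
    using Int[OF that] E by blast
  have fin: "finite ?pos" "finite ?neg" "finite ?on"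
    by (rule finite_subset[OF _ finite_facets[OF Q]]; auto simp: on_facets_def)+
  have "{F. F facet_of (?cone Q) \<and> E \<subseteq> F} = ?pos \<union> ?cone ` {K \<in> ?M. E \<subseteq> K}"
    unfolding facet_of_hull_insert_iff[OF Q v] using E_iff by blast
  moreover have "?pos \<inter> ?cone ` {K \<in> ?M. E \<subseteq> K} = {}"
  proof -
    have "v \<notin> F" if "F \<in> ?pos" for F using that v facet_of_imp_subset by blast
    moreover have "v \<in> ?cone K" for K by (simp add: hull_inc)
    ultimately show ?thesis by blast
  qed
  ultimately have "facet_degree (?cone Q) E = card ?pos + card (?cone ` {K \<in> ?M. E \<subseteq> K})"
    using fin finite_on_facets[OF Q] finite_horizon[OF Q]
    by (simp add: facet_degree_def card_Un_disjoint)
  also have "card (?cone ` {K \<in> ?M. E \<subseteq> K}) = card ?on + card {R \<in> horizon Q v. E \<subseteq> R}"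
    by (rule card_hull_insert_cones[OF Q])
  finally have 1: "facet_degree (?cone Q) E = card ?pos + card ?on + card {R \<in> horizon Q v. E \<subseteq> R}"
    by simp
  have "facet_degree Q E = card ((?pos \<union> ?on) \<union> ?neg)"
    unfolding facet_degree_def by (rule arg_cong[of _ _ card]) (auto simp: on_facets_def)
  moreover have "card ((?pos \<union> ?on) \<union> ?neg) = card (?pos \<union> ?on) + card ?neg"
    using fin by (intro card_Un_disjoint) (auto simp: on_facets_def)
  moreover have "card (?pos \<union> ?on) = card ?pos + card ?on"
    using fin by (intro card_Un_disjoint) (auto simp: on_facets_def)
  ultimately have "facet_degree Q E = card ?pos + card ?on + card ?neg"
    by linarith
  then show ?thesis using 1 by simp
qed

text \<open>No facet of \<open>Q\<close> contains \<open>v\<close>, so only cones count; a cone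
  meets \<open>Q\<close> just in its base, so it contains the segment exactly when its base contains
  \<open>x\<close>.\<close>

lemma facet_degree_hull_insert_new:
  assumes Q: "polytope4 Q" and v: "v \<notin> Q" and x: "x \<in> Q"
  shows "facet_degree (convex hull (insert v Q)) (convex hull {x, v}) =
    card {K \<in> on_facets Q v. x \<in> K} + card {R \<in> horizon Q v. x \<in> R}"
proof -
  let ?M = "on_facets Q v \<union> horizon Q v"
  let ?cone = "\<lambda>K. convex hull (insert v K)"
  have Int: "?cone K \<inter> Q = K" if "K \<in> ?M" for K
    using that hull_insert_on_Int[OF Q] hull_insert_horizon_Int[OF Q] by blast
  have seg_iff: "convex hull {x, v} \<subseteq> F \<longleftrightarrow> x \<in> F \<and> v \<in> F" if "convex F" for F
    using that by (simp add: subset_hull)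
  have cone: "convex hull {x, v} \<subseteq> ?cone K \<longleftrightarrow> x \<in> K" if "K \<in> ?M" for K
    using Int[OF that] x hull_inc[of v "insert v K" convex] by (subst seg_iff) auto
  have nv: "\<not> convex hull {x, v} \<subseteq> F" if "F facet_of Q" for F
    using that v facet_of_imp_subset hull_subset[of "{x, v}" convex] by blast
  have "{F. F facet_of (?cone Q) \<and> convex hull {x, v} \<subseteq> F} = ?cone ` {K \<in> ?M. {x} \<subseteq> K}"
    unfolding facet_of_hull_insert_iff[OF Q v] using cone nv by auto
  then show ?thesis
    using card_hull_insert_cones[OF Q, of v "{x}"] by (simp add: facet_degree_def)
qed

section \<open>Triangles and edges of the enlarged polytope\<close>

lemma affine_hull_small_face:
  assumes Q: "polytope4 Q"
    and nadj: "\<And>G H. G \<in> on_facets Q v \<Longrightarrow> H \<in> on_facets Q v \<Longrightarrow> \<not> adjacent_facets Q G H"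
    and K: "K face_of Q" "aff_dim K \<le> 2"
  shows "v \<notin> affine hull K"
proof
  assume v: "v \<in> affine hull K"
  then have "K \<noteq> {}" by auto
  \<comment> \<open>The affine hull of \<open>K\<close> lies in both facet hyperplanes, so
    \<open>v\<close> would be on two adjacent facets.\<close>
  then obtain G H where GH: "adjacent_facets Q G H" "K \<subseteq> G \<inter> H"
    using face_in_adjacent_facets[OF Q K(1) _ K(2)] by blast
  note d = adjacent_facetsD[OF GH(1)]
  have "v \<in> affine hull G" "v \<in> affine hull H"
    using v GH(2) hull_mono[of K G affine] hull_mono[of K H affine] by auto
  then have "G \<in> on_facets Q v" "H \<in> on_facets Q v"
    using affine_hull_facet_iff[OF Q] d by (auto simp: on_facets_def)
  then show False using nadj GH(1) by blast
qed

text \<open>A new 2-face is a cone over a face of \<open>Q\<close> whose affine hull misses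
  \<open>v\<close>. That base has dimension 1, so it is a segment and the cone is a
  triangle.\<close>

lemma two_simplicial_hull_insert:
  assumes Q: "polytope4 Q" and simp: "two_simplicial Q"
    and nadj: "\<And>G H. G \<in> on_facets Q v \<Longrightarrow> H \<in> on_facets Q v \<Longrightarrow> \<not> adjacent_facets Q G H"
  shows "two_simplicial (convex hull (insert v Q))"
  unfolding two_simplicial_def
proof (intro allI impI, elim conjE)
  fix F assume F: "F face_of (convex hull (insert v Q))" and dF: "aff_dim F = 2"
  note fc = hull_insert_face_cases[OF polytope4_convex[OF Q] polytope4_nonempty[OF Q] F]
  show "2 simplex F"
  proof (cases "v \<in> F")
    case False
    then have "F \<inter> Q = F" using fc(2) by blast
    then show ?thesis using fc(1) dF simp by (auto simp: two_simplicial_def)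
  next
    case True
    let ?K = "F \<inter> Q"
    have eq: "convex hull (insert v ?K) = F" by (rule fc(3)[OF True])
    have d: "aff_dim (insert v ?K) = 2" using eq dF by (metis aff_dim_convex_hull)
    then have "aff_dim ?K \<le> 2" using aff_dim_subset[OF subset_insertI[of ?K v]] by linarith
    then have v: "v \<notin> affine hull ?K" using affine_hull_small_face[OF Q nadj fc(1)] by blast
    then have d1: "aff_dim ?K = 1" using d by (simp add: aff_dim_insert)
    have "polytope ?K" using fc(1) Q face_of_polytope_polytope by (auto simp: polytope4_def)
    then obtain n where n: "n simplex ?K"
      using polytope_lowdim_imp_simplex d1 by (metis order_refl)
    then have "n = 1" using d1 aff_dim_simplex by metis
    then show ?thesis using simplex_insert_dimplus1[OF n v] eq by simp
  qed
qed

text \<open>A new edge joins \<open>v\<close> to a vertex \<open>x\<close>. If no facet through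
  \<open>x\<close> were negative at \<open>v\<close>, one could move from \<open>x\<close> towards
  \<open>v\<close> inside \<open>Q\<close>, and the edge would already meet \<open>Q\<close> in more
  than \<open>x\<close>.\<close>

lemma edge_hull_insert_cases:
  assumes Q: "polytope4 Q" and vQ: "v \<notin> Q"
    and nadj: "\<And>G H. G \<in> on_facets Q v \<Longrightarrow> H \<in> on_facets Q v \<Longrightarrow> \<not> adjacent_facets Q G H"
    and E: "E face_of (convex hull (insert v Q))" "aff_dim E = 1"
  shows "E face_of Q \<or> (\<exists>x H. x extreme_point_of Q \<and> H facet_of Q \<and> facet_slack Q H v < 0 \<and>
    x \<in> H \<and> E = convex hull {x, v})"
proof -
  note fc = hull_insert_face_cases[OF polytope4_convex[OF Q] polytope4_nonempty[OF Q] E(1)]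
  show ?thesis
  proof (cases "v \<in> E")
    case False
    then have "E \<inter> Q = E" using fc(2) by blast
    then show ?thesis using fc(1) by simp
  next
    case True
    let ?K = "E \<inter> Q"
    have eq: "convex hull (insert v ?K) = E" by (rule fc(3)[OF True])
    have d: "aff_dim (insert v ?K) = 1" using eq E(2) by (metis aff_dim_convex_hull)
    then have "aff_dim ?K \<le> 2" using aff_dim_subset[OF subset_insertI[of ?K v]] by linarith
    then have v: "v \<notin> affine hull ?K" using affine_hull_small_face[OF Q nadj fc(1)] by blast
    then have "aff_dim ?K = 0" using d by (simp add: aff_dim_insert)
    then obtain x where x: "?K = {x}" using aff_dim_eq_0 by blast
    have "x extreme_point_of Q" using fc(1) x by (simp add: face_of_singleton)
    moreover have "\<exists>H. H facet_of Q \<and> x \<in> H \<and> facet_slack Q H v < 0"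
    proof (rule ccontr)
      assume neg: "\<not> ?thesis"
      have "v \<in> affine hull ?K"
        by (rule hull_insert_face_direction[OF Q E(1) True, of x 1]) (use x neg in \<open>auto simp: not_less\<close>)
      then show False using v by blast
    qed
    moreover have "E = convex hull {x, v}" using eq x by (simp add: insert_commute)
    ultimately show ?thesis by blast
  qed
qed

section \<open>Simplex facets\<close>

lemma simplex_facet_affine_independent:
  assumes Q: "polytope4 Q" and C: "convex hull C facet_of Q" "finite C" "card C \<le> 4"
  shows "\<not> affine_dependent C" "card C = 4"
proof -
  have d: "aff_dim C = 3" using C Q by (simp add: polytope4_facet_iff aff_dim_convex_hull)
  have "aff_dim C \<le> int (card C) - 1" using C(2) aff_dim_le_card by blast
  then show "card C = 4" using d C by simp
  then show "\<not> affine_dependent C" using d C by (simp add: affine_independent_iff_card)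
qed

lemma convex_hull_vertex_iff:
  fixes C :: "'a::euclidean_space set"
  assumes "\<not> affine_dependent C" "A \<subseteq> C" "x \<in> C"
  shows "x \<in> convex hull A \<longleftrightarrow> x \<in> A"
proof
  show "x \<in> A" if x: "x \<in> convex hull A"
  proof (rule ccontr)
    assume "x \<notin> A"
    then have "A \<subseteq> C - {x}" using assms by blast
    then have "x \<in> affine hull (C - {x})"
      using x convex_hull_subset_affine_hull[of A] hull_mono[of A "C - {x}" affine] by blast
    then show False using assms by (auto simp: affine_dependent_def)
  qed
qed (rule hull_inc)

lemma convex_hull_subset_iff:
  fixes C :: "'a::euclidean_space set"
  assumes "\<not> affine_dependent C" "A \<subseteq> C" "A' \<subseteq> C"
  shows "convex hull A \<subseteq> convex hull A' \<longleftrightarrow> A \<subseteq> A'"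
proof
  show "A \<subseteq> A'" if "convex hull A \<subseteq> convex hull A'"
    using that assms(2) convex_hull_vertex_iff[OF assms(1,3)] hull_subset[of A convex] by blast
qed (rule hull_mono)

lemma convex_hull_inj:
  fixes C :: "'a::euclidean_space set"
  assumes "\<not> affine_dependent C" "A \<subseteq> C" "A' \<subseteq> C" "convex hull A = convex hull A'"
  shows "A = A'"
  using convex_hull_subset_iff[OF assms(1-3)] convex_hull_subset_iff[OF assms(1,3,2)] assms(4) by blast

lemma aff_dim_convex_hull_subset:
  fixes C :: "'a::euclidean_space set"
  assumes "\<not> affine_dependent C" "A \<subseteq> C"
  shows "aff_dim (convex hull A) = int (card A) - 1"
proof -
  have "\<not> affine_dependent A" using affine_dependent_subset assms by blast
  then show ?thesis
    using aff_dim_affine_independent[of A] by (simp add: aff_dim_convex_hull)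
qed

text \<open>Exceptional edges need not lie in one simplex, so affine independence of a common vertex
  set is not at hand; the extreme points of a segment identify its ends instead.\<close>

lemma convex_hull_doubleton_inj:
  fixes e e' :: "'a::euclidean_space set"
  assumes "card e = 2" "card e' = 2" "convex hull e = convex hull e'"
  shows "e = e'"
proof -
  have ext: "{x. x extreme_point_of (convex hull s)} = s" if s2: "card s = 2" for s :: "'a set"
  proof -
    obtain a b where s: "s = {a, b}" using s2 unfolding card_2_iff by blast
    show ?thesis unfolding s extreme_point_of_convex_hull_2 by blast
  qed
  have "e = {x. x extreme_point_of (convex hull e)}" using ext[OF assms(1)] by (rule sym)
  also have "\<dots> = e'" unfolding assms(3) by (rule ext[OF assms(2)])
  finally show ?thesis .
qed

lemma convex_hull_doubleton_image_iff:
  fixes a b :: "'a::euclidean_space"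
  assumes D: "\<And>e. e \<in> D \<Longrightarrow> card e = 2" and "a \<noteq> b"
  shows "convex hull {a, b} \<in> (hull) convex ` D \<longleftrightarrow> {a, b} \<in> D"
proof
  assume "convex hull {a, b} \<in> (hull) convex ` D"
  then obtain e where e: "e \<in> D" "convex hull {a, b} = convex hull e" by blast
  have "{a, b} = e"
    using convex_hull_doubleton_inj[OF _ D[OF e(1)] e(2)] \<open>a \<noteq> b\<close> by simp
  then show "{a, b} \<in> D" using e(1) by simp
qed (rule imageI)

text \<open>The facet is carried as its vertex set, so that its faces become subsets of
  \<open>C\<close> and its neighbours can be indexed by the vertex they omit.\<close>

locale simplex_facet_of_polytope =
  fixes Q C :: "pt set"
  assumes Q: "polytope4 Q" and T: "convex hull C facet_of Q"
    and fin: "finite C" and card4: "card C = 4"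
begin

abbreviation "T \<equiv> convex hull C"

lemma indep: "\<not> affine_dependent C"
  using simplex_facet_affine_independent[OF Q T fin] card4 by simp

lemma face: "A \<subseteq> C \<Longrightarrow> convex hull A face_of Q"
  using face_of_convex_hull_affine_independent[OF indep]
    face_of_trans[OF _ facet_of_imp_face_of[OF T]] by blast

lemma aff_dim_face: "A \<subseteq> C \<Longrightarrow> aff_dim (convex hull A) = int (card A) - 1"
  by (rule aff_dim_convex_hull_subset[OF indep])

lemma vertex_iff: "A \<subseteq> C \<Longrightarrow> x \<in> C \<Longrightarrow> x \<in> convex hull A \<longleftrightarrow> x \<in> A"
  by (rule convex_hull_vertex_iff[OF indep])

lemma ridge_inj: "x \<in> C \<Longrightarrow> y \<in> C \<Longrightarrow> convex hull (C - {x}) = convex hull (C - {y}) \<Longrightarrow> x = y"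
  using convex_hull_inj[OF indep, of "C - {x}" "C - {y}"] by blast

lemma vertices_in_Q: "C \<subseteq> Q"
  using T facet_of_imp_subset hull_subset[of C convex] by blast

lemma face_subset_cases:
  assumes "K face_of Q" "K \<subseteq> T"
  obtains A where "A \<subseteq> C" "K = convex hull A"
proof -
  have "K face_of T" using assms face_of_face[OF facet_of_imp_face_of[OF T]] by blast
  then show ?thesis using face_of_convex_hull_affine_independent[OF indep] that by blast
qed

lemma edge_cases:
  assumes "E face_of Q" "E \<subseteq> T" "aff_dim E = 1"
  obtains a b where "a \<in> C" "b \<in> C" "a \<noteq> b" "E = convex hull {a, b}"
proof -
  obtain A where A: "A \<subseteq> C" "E = convex hull A" using face_subset_cases[OF assms(1,2)] .
  then have "card A = 2" using aff_dim_face assms(3) by simp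
  then show ?thesis using A that by (auto simp: card_2_iff)
qed

lemma adjacent_cases:
  assumes "adjacent_facets Q T G"
  obtains x where "x \<in> C" "T \<inter> G = convex hull (C - {x})"
proof -
  note d = adjacent_facetsD[OF assms]
  obtain A where A: "A \<subseteq> C" "T \<inter> G = convex hull A"
    using face_subset_cases[OF d(4)] by blast
  then have "card A = 3" using aff_dim_face[of A] d(5) by simp
  then have "card (C - A) = 1" using A fin card4 by (simp add: card_Diff_subset finite_subset)
  then obtain x where "C - A = {x}" by (auto simp: card_1_singleton_iff)
  then have "A = C - {x}" "x \<in> C" using A by auto
  then show ?thesis using A that by blast
qed

lemma neighbour_ex:
  assumes x: "x \<in> C"
  shows "\<exists>G. adjacent_facets Q T G \<and> T \<inter> G = convex hull (C - {x})"
proof -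
  let ?R = "convex hull (C - {x})"
  have R: "?R face_of Q" "aff_dim ?R = 2"
    using face[of "C - {x}"] aff_dim_face[of "C - {x}"] x fin card4 by auto
  obtain G H where GH: "adjacent_facets Q G H" "G \<inter> H = ?R" "{F. F facet_of Q \<and> ?R \<subseteq> F} = {G, H}"
    using ridge_facets[OF Q R] .
  have "?R \<subseteq> T" by (intro hull_mono) blast
  then have "T \<in> {G, H}" using T unfolding GH(3)[symmetric] by blast
  then show ?thesis
    using GH(1,2) by (auto simp: adjacent_facets_def Int_commute)
qed

text \<open>The neighbour is indexed by the vertex of \<open>C\<close> opposite the shared ridge; it
  is unique because a ridge lies in just two facets.\<close>

definition nb :: "pt \<Rightarrow> pt set" where
  "nb x = (SOME G. adjacent_facets Q T G \<and> T \<inter> G = convex hull (C - {x}))"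

lemma nb:
  assumes "x \<in> C"
  shows "adjacent_facets Q T (nb x)" "T \<inter> nb x = convex hull (C - {x})"
  using someI_ex[OF neighbour_ex[OF assms]] unfolding nb_def by blast+

lemma nb_unique:
  assumes x: "x \<in> C" and H: "H facet_of Q" "H \<noteq> T" "C - {x} \<subseteq> H"
  shows "H = nb x"
proof -
  have "convex hull (C - {x}) \<subseteq> H"
    using H(3) face_of_imp_convex[OF facet_of_imp_face_of[OF H(1)]] by (rule hull_minimal)
  then show ?thesis using adjacent_facets_only[OF Q nb(1)[OF x] H(1)] nb(2)[OF x] H(2) by simp
qed

lemma adjacent_imp_nb:
  assumes "adjacent_facets Q T G" "x \<in> C" "T \<inter> G = convex hull (C - {x})"
  shows "G = nb x"
proof (rule nb_unique[OF assms(2)])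
  show "G facet_of Q" "G \<noteq> T" using adjacent_facetsD[OF assms(1)] by auto
  show "C - {x} \<subseteq> G" using assms(3) hull_subset[of "C - {x}" convex] by blast
qed

lemma vertex_nb_iff:
  assumes "x \<in> C" "y \<in> C"
  shows "y \<in> nb x \<longleftrightarrow> y \<noteq> x"
proof -
  have "y \<in> T" using assms(2) by (simp add: hull_inc)
  then have "y \<in> nb x \<longleftrightarrow> y \<in> convex hull (C - {x})" using nb(2)[OF assms(1)] by blast
  then show ?thesis using vertex_iff[of "C - {x}" y] assms(2) by auto
qed

lemma nb_inj: "x \<in> C \<Longrightarrow> y \<in> C \<Longrightarrow> nb x = nb y \<Longrightarrow> x = y"
  using vertex_nb_iff by blast

text \<open>Translates the shared triangles used in the constructions into omitted vertices.\<close>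

lemma across_eq:
  assumes X: "X \<subseteq> C"
  shows "across Q T ((\<lambda>x. C - {x}) ` X) = nb ` X"
proof (intro equalityI subsetI)
  fix G assume "G \<in> across Q T ((\<lambda>x. C - {x}) ` X)"
  then obtain x where x: "adjacent_facets Q T G" "x \<in> X" "T \<inter> G = convex hull (C - {x})"
    by (auto simp: across_def)
  then have "G = nb x" using adjacent_imp_nb X by blast
  then show "G \<in> nb ` X" using x(2) by blast
next
  fix G assume "G \<in> nb ` X"
  then obtain x where x: "x \<in> X" "G = nb x" by blast
  then have "x \<in> C" using X by blast
  then show "G \<in> across Q T ((\<lambda>x. C - {x}) ` X)"
    using nb[of x] x unfolding across_def by blast
qed

end

section \<open>The invariant: 2-simplicial polytopes with listed edges of degree 4\<close>

text \<open>The set \<open>B\<close> lists the exceptional edges by their two end points.\<close>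

definition simple_except :: "pt set \<Rightarrow> pt set set \<Rightarrow> bool" where
  "simple_except Q B \<longleftrightarrow> polytope4 Q \<and> two_simplicial Q \<and> (\<forall>e\<in>B. card e = 2 \<and> e \<subseteq> Q) \<and>
     (\<forall>E. E face_of Q \<and> aff_dim E = 1 \<longrightarrow>
        facet_degree Q E = (if E \<in> (hull) convex ` B then 4 else 3))"

lemma simple_except_iff_two_simple:
  "simple_except Q {} \<longleftrightarrow> polytope4 Q \<and> two_simple Q \<and> two_simplicial Q"
  by (auto simp: simple_except_def two_simple_def facet_degree_def)

lemma simple_except_degree:
  assumes "simple_except Q B" "convex hull {a, b} face_of Q" "a \<noteq> b"
  shows "facet_degree Q (convex hull {a, b}) = (if {a, b} \<in> B then 4 else 3)"
proof -
  have "convex hull {a, b} \<in> (hull) convex ` B \<longleftrightarrow> {a, b} \<in> B"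
    using assms(1) by (intro convex_hull_doubleton_image_iff assms(3)) (auto simp: simple_except_def)
  then show ?thesis using assms by (simp add: simple_except_def aff_dim_convex_hull)
qed

lemma region_slack:
  assumes Q: "polytope4 Q" and T: "T facet_of Q" and x: "x \<in> region Q T (across Q T As) (across Q T Bs)"
    and F: "F facet_of Q"
  shows "F \<in> insert T (across Q T Bs) \<Longrightarrow> facet_slack Q F x < 0"
    and "F \<in> across Q T As \<Longrightarrow> facet_slack Q F x = 0"
    and "F \<notin> insert T (across Q T As \<union> across Q T Bs) \<Longrightarrow> facet_slack Q F x > 0"
  using x F neg_side_slack[OF Q F] pos_side_slack[OF Q F] affine_hull_facet_iff[OF Q F]
  unfolding region_def by blast+

section \<open>Placing a point beyond one simplex facet\<close>

text \<open>The last two clauses supply the simplex facets on which later steps operate: cones over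
  the ridges opposite unchosen vertices, and old simplex facets that survive. Such a
  \<open>D\<close> survives because a chosen neighbour omits its vertex in \<open>X\<close> whereas
  \<open>D\<close> contains all of \<open>X\<close>.\<close>

definition stacked :: "pt set \<Rightarrow> pt \<Rightarrow> pt set \<Rightarrow> pt set \<Rightarrow> pt set set \<Rightarrow> bool" where
  "stacked Q v C X B \<longleftrightarrow> v \<notin> Q \<and> simple_except (convex hull (insert v Q)) B \<and>
    (\<forall>x\<in>C - X. convex hull (insert v (C - {x})) facet_of convex hull (insert v Q)) \<and>
    (\<forall>D. convex hull D facet_of Q \<and> finite D \<and> card D = 4 \<and> X \<subseteq> D \<and> \<not> D \<subseteq> C \<longrightarrow>
       convex hull D facet_of convex hull (insert v Q))"

lemma stacked_new_facet:
  assumes "stacked Q v C X B" "x \<in> C - X" "insert v (C - {x}) = D"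
  shows "convex hull D facet_of convex hull (insert v Q)"
  using assms unfolding stacked_def by blast

lemma stacked_old_facet:
  assumes "stacked Q v C X B" "convex hull D facet_of Q" "finite D" "card D = 4" "X \<subseteq> D" "\<not> D \<subseteq> C"
  shows "convex hull D facet_of convex hull (insert v Q)"
  using assms unfolding stacked_def by blast

text \<open>Two facets in \<open>across Q T As\<close> that were adjacent would close up, together with \<open>T\<close>, the cycle of facets
  around the edge they share with \<open>T\<close>. The exceptional degree 4 of that edge excludes this.\<close>

lemma simplex_step:
  assumes inv: "simple_except Q B" and T: "convex hull C facet_of Q" and C: "finite C" "card C = 4"
    and X: "X \<subseteq> C"
    and As: "As = (\<lambda>x. C - {x}) ` X"
    and v: "v \<in> region Q (convex hull C) (across Q (convex hull C) As) {}"
    and on0: "\<forall>x\<in>X. \<forall>y\<in>X. x \<noteq> y \<longrightarrow> C - {x, y} \<in> B"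
    and B0: "\<forall>e\<in>B. e \<in> B' \<or> e \<subseteq> C" "\<forall>e\<in>B'. e \<in> B \<or> e \<subseteq> C \<and> card e = 2"
    and deg0: "\<forall>a\<in>C. \<forall>b\<in>C. a \<noteq> b \<longrightarrow>
      (if {a, b} \<in> B then 4 else 3) + card (C - X - {a, b}) = (if {a, b} \<in> B' then 5 else 4)"
  shows "stacked Q v C X B'"
proof -
  let ?Q = "convex hull (insert v Q)"
  let ?A = "across Q (convex hull C) ((\<lambda>x. C - {x}) ` X)"
  have on: "C - {x, y} \<in> B" if "x \<in> X" "y \<in> X" "x \<noteq> y" for x y
    using on0 that by blast
  have B': "B - B' \<subseteq> Pow C" "\<And>e. e \<in> B' - B \<Longrightarrow> e \<subseteq> C \<and> card e = 2"
    using B0 by blast+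
  have deg: "(if {a, b} \<in> B then 4 else 3) + card (C - X - {a, b}) = (if {a, b} \<in> B' then 5 else 4)"
    if "a \<in> C" "b \<in> C" "a \<noteq> b" for a b
    using deg0 that by blast
  have Q: "polytope4 Q" and ts: "two_simplicial Q" using inv by (auto simp: simple_except_def)
  interpret simplex_facet_of_polytope Q C
    using Q T C by unfold_locales
  have emp: "across Q T {} = {}" by (simp add: across_def)
  have v': "v \<in> region Q T ?A (across Q T {})" using v unfolding emp As .
  note sl = region_slack[OF Q T v']
  have negT: "facet_slack Q T v < 0" using sl(1)[OF T] by simp
  have vQ: "v \<notin> Q" using negT facet_slack_nonneg[OF Q T, of v] by linarith
  have A_eq: "?A = nb ` X" by (rule across_eq[OF X])
  have nb_facet: "nb x facet_of Q" if "x \<in> C" for x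
    using adjacent_facetsD(2)[OF nb(1)[OF that]] .
  have A_facet: "G facet_of Q" if "G \<in> ?A" for G
    using that nb_facet X unfolding A_eq by blast
  have neg: "F facet_of Q \<and> facet_slack Q F v < 0 \<longleftrightarrow> F = T" for F
  proof
    assume F: "F facet_of Q \<and> facet_slack Q F v < 0"
    then have "F \<notin> ?A" using sl(2)[of F] by fastforce
    then show "F = T" using sl(3)[of F] F emp by fastforce
  qed (use negT T in blast)
  have on_eq: "on_facets Q v = ?A"
  proof (intro equalityI subsetI)
    fix F assume "F \<in> on_facets Q v"
    then have F: "F facet_of Q" "facet_slack Q F v = 0" by (auto simp: on_facets_def)
    then have "F \<noteq> T" using negT by force
    then show "F \<in> ?A" using sl(3)[OF F(1)] F(2) emp by fastforce
  next
    fix F assume F: "F \<in> ?A"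
    then show "F \<in> on_facets Q v" using sl(2)[OF A_facet[OF F] F] A_facet[OF F] by (simp add: on_facets_def)
  qed
  have nb_in_A: "nb x \<in> ?A \<longleftrightarrow> x \<in> X" if "x \<in> C" for x
    unfolding A_eq using nb_inj[OF that] X by blast
  \<comment> \<open>\<open>T\<close> is the only facet negative at \<open>v\<close>, so a horizon
    ridge lies on \<open>T\<close>, and its other facet is an unchosen neighbour.\<close>
  have hor: "horizon Q v = (\<lambda>x. convex hull (C - {x})) ` (C - X)"
  proof (intro equalityI subsetI)
    fix R assume "R \<in> horizon Q v"
    then obtain G H where GH: "R = G \<inter> H" "adjacent_facets Q G H" "facet_slack Q G v > 0" "facet_slack Q H v < 0"
      by (auto simp: horizon_def)
    then have H: "H = T" using neg adjacent_facetsD(2) by blast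
    have adj: "adjacent_facets Q T G" using GH H by (auto simp: adjacent_facets_def Int_commute)
    then obtain x where x: "x \<in> C" "T \<inter> G = convex hull (C - {x})" using adjacent_cases by blast
    have "x \<notin> X"
    proof
      assume "x \<in> X"
      then have "G \<in> ?A" unfolding A_eq using adjacent_imp_nb[OF adj x] by blast
      then show False using sl(2)[OF A_facet] GH(3) by force
    qed
    then show "R \<in> (\<lambda>x. convex hull (C - {x})) ` (C - X)"
      using x GH H by blast
  next
    fix R assume "R \<in> (\<lambda>x. convex hull (C - {x})) ` (C - X)"
    then obtain x where x: "x \<in> C" "x \<notin> X" "R = convex hull (C - {x})" by blast
    note d = adjacent_facetsD[OF nb(1)[OF x(1)]]
    have "facet_slack Q (nb x) v > 0"
      using sl(3)[OF d(2)] d(3) nb_in_A[OF x(1)] x(2) emp by blast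
    moreover have "adjacent_facets Q (nb x) T" "R = nb x \<inter> T"
      using nb[OF x(1)] x by (auto simp: adjacent_facets_def Int_commute)
    ultimately show "R \<in> horizon Q v" using negT unfolding horizon_def by blast
  qed
  have card_hor: "card {R \<in> horizon Q v. A \<subseteq> R} = card (C - X - A)" if "A \<subseteq> C" for A
  proof -
    have "{R \<in> horizon Q v. A \<subseteq> R} = (\<lambda>x. convex hull (C - {x})) ` (C - X - A)"
    proof -
      have "A \<subseteq> convex hull (C - {x}) \<longleftrightarrow> x \<notin> A" if "x \<in> C" for x
        using vertex_iff[of "C - {x}"] \<open>A \<subseteq> C\<close> that by blast
      then show ?thesis unfolding hor by blast
    qed
    moreover have "inj_on (\<lambda>x. convex hull (C - {x})) (C - X - A)"
      using ridge_inj by (auto intro!: inj_onI)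
    ultimately show ?thesis by (simp add: card_image)
  qed
  have nadj: "\<not> adjacent_facets Q G H" if GH: "G \<in> on_facets Q v" "H \<in> on_facets Q v" for G H
  proof
    assume adj: "adjacent_facets Q G H"
    have "G \<in> nb ` X" "H \<in> nb ` X" using GH unfolding on_eq A_eq by auto
    then obtain x y where xy: "x \<in> X" "G = nb x" "y \<in> X" "H = nb y" by blast
    then have ne: "x \<noteq> y" using adj by (auto simp: adjacent_facets_def)
    have xyC: "x \<in> C" "y \<in> C" using xy X by auto
    let ?e = "C - {x, y}"
    have c2: "card ?e = 2" using card4 C ne xyC by simp
    have sub: "convex hull ?e \<subseteq> convex hull (C - {x})" "convex hull ?e \<subseteq> convex hull (C - {y})"
      by (intro hull_mono; blast)+
    have d1: "aff_dim (convex hull ?e) = 1" using aff_dim_face[of ?e] c2 by auto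
    have "convex hull ?e \<subseteq> T" by (intro hull_mono) blast
    moreover have "convex hull ?e \<subseteq> nb x" "convex hull ?e \<subseteq> nb y"
      using sub nb(2)[OF xyC(1)] nb(2)[OF xyC(2)] by blast+
    ultimately have "facet_degree Q (convex hull ?e) = 3"
      using three_adjacent_facets_degree[OF Q d1 _ _ _ nb(1)[OF xyC(1)] _ nb(1)[OF xyC(2)]] adj
      unfolding xy(2,4) by blast
    moreover have "convex hull ?e \<in> (hull) convex ` B" using on[OF xy(1,3) ne] by (rule imageI)
    then have "facet_degree Q (convex hull ?e) = 4"
      using inv d1 face[of ?e] unfolding simple_except_def by auto
    ultimately show False by simp
  qed
  have neg_set: "{F. F facet_of Q \<and> facet_slack Q F v < 0 \<and> E \<subseteq> F} = (if E \<subseteq> T then {T} else {})" for E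
  proof -
    have "F facet_of Q \<and> facet_slack Q F v < 0 \<and> E \<subseteq> F \<longleftrightarrow> F = T \<and> E \<subseteq> T" for F
      using neg[of F] by auto
    then show ?thesis by auto
  qed
  have hor_sub: "convex R" "R \<subseteq> T" if "R \<in> horizon Q v" for R
    using that hull_mono[of "C - {_}" C convex] unfolding hor by auto
  note Q' = polytope4_hull_insert[OF Q, of v]
  have "simple_except ?Q B'"
    unfolding simple_except_def
  proof (intro conjI ballI allI impI)
    show "polytope4 ?Q" by (rule Q')
    show "two_simplicial ?Q" by (rule two_simplicial_hull_insert[OF Q ts nadj])
    have old: "\<forall>e\<in>B. card e = 2 \<and> e \<subseteq> Q" using inv by (simp add: simple_except_def)
    have new: "card e = 2 \<and> e \<subseteq> Q" if "e \<in> B'" for e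
      using old that B'(2)[of e] vertices_in_Q by (cases "e \<in> B") auto
    have QQ: "Q \<subseteq> ?Q" by (auto intro: hull_inc)
    show "card e = 2" "e \<subseteq> ?Q" if "e \<in> B'" for e
      using new[OF that] QQ by auto
    fix E assume "E face_of ?Q \<and> aff_dim E = 1"
    then have E: "E face_of ?Q" "aff_dim E = 1" by auto
    have "E face_of Q \<or> (\<exists>x H. x extreme_point_of Q \<and> H facet_of Q \<and> facet_slack Q H v < 0 \<and>
        x \<in> H \<and> E = convex hull {x, v})"
      by (rule edge_hull_insert_cases[OF Q vQ _ E]) (rule nadj)
    then consider "E face_of Q"
      | x H where "x extreme_point_of Q" "H facet_of Q" "facet_slack Q H v < 0" "x \<in> H"
          "E = convex hull {x, v}" by blast
    then show "facet_degree ?Q E = (if E \<in> (hull) convex ` B' then 4 else 3)"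
    proof cases
      case 1
      have form: "facet_degree ?Q E + card {F. F facet_of Q \<and> facet_slack Q F v < 0 \<and> E \<subseteq> F}
          = facet_degree Q E + card {R \<in> horizon Q v. E \<subseteq> R}"
        by (rule facet_degree_hull_insert_old[OF Q vQ face_of_imp_subset[OF 1]])
      have degE: "facet_degree Q E = (if E \<in> (hull) convex ` B then 4 else 3)"
        using inv 1 E by (simp add: simple_except_def)
      show ?thesis
      proof (cases "E \<subseteq> T")
        case True
        then obtain a b where ab: "a \<in> C" "b \<in> C" "a \<noteq> b" "E = convex hull {a, b}"
          using edge_cases[OF 1 True E(2)] by blast
        have "E \<subseteq> R \<longleftrightarrow> {a, b} \<subseteq> R" if "R \<in> horizon Q v" for R
          unfolding ab(4) by (rule subset_hull) (rule hor_sub(1)[OF that])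
        then have "{R \<in> horizon Q v. E \<subseteq> R} = {R \<in> horizon Q v. {a, b} \<subseteq> R}" by blast
        then have "card {R \<in> horizon Q v. E \<subseteq> R} = card (C - X - {a, b})"
          using card_hor[of "{a, b}"] ab(1,2) by simp
        \<comment> \<open>The 1 on the left is the lost facet \<open>T\<close>; this is why
          \<open>deg0\<close> has 5 and 4 on its right side instead of 4 and 3.\<close>
        then have 2: "facet_degree ?Q E + 1 = facet_degree Q E + card (C - X - {a, b})"
          using form True unfolding neg_set by simp
        have "facet_degree Q E = (if {a, b} \<in> B then 4 else 3)"
          using simple_except_degree[OF inv, of a b] 1 ab(3) unfolding ab(4) by blast
        then have "facet_degree ?Q E + 1 = (if {a, b} \<in> B' then 5 else 4)"
          using 2 deg[OF ab(1-3)] by presburger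
        moreover have "E \<in> (hull) convex ` B' \<longleftrightarrow> {a, b} \<in> B'"
          unfolding ab(4) by (rule convex_hull_doubleton_image_iff[OF _ ab(3)]) (use new in blast)
        ultimately show ?thesis by (simp split: if_splits)
      next
        case False
        have "{R \<in> horizon Q v. E \<subseteq> R} = {}" using False hor_sub(2) by blast
        then have "card {R \<in> horizon Q v. E \<subseteq> R} = 0" by (simp only: card.empty)
        then have "facet_degree ?Q E = facet_degree Q E" using form False unfolding neg_set by simp
        \<comment> \<open>The two lists differ only in pairs inside \<open>C\<close>, whose segments
          lie in \<open>T\<close>.\<close>
        moreover have "E \<in> (hull) convex ` B' \<longleftrightarrow> E \<in> (hull) convex ` B"
        proof -
          have "e \<in> B \<longleftrightarrow> e \<in> B'" if "E = convex hull e" for e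
          proof -
            have "\<not> e \<subseteq> C" using hull_mono[of e C convex] False that by blast
            then show ?thesis using B'(1) B'(2)[of e] by blast
          qed
          then show ?thesis by (auto simp: image_iff)
        qed
        ultimately show ?thesis using degE by simp
      qed
    next
      case (2 x H)
      then have "H = T" using neg by blast
      then have "x extreme_point_of T" using 2 T extreme_point_of_face facet_of_imp_face_of by blast
      then have x: "x \<in> C" using extreme_point_of_convex_hull by blast
      have "x \<in> nb y \<longleftrightarrow> x \<noteq> y" if "y \<in> X" for y
        using vertex_nb_iff[OF _ x, of y] X that by blast
      then have "{K \<in> on_facets Q v. x \<in> K} = nb ` (X - {x})"
        unfolding on_eq A_eq by auto
      moreover have "inj_on nb (X - {x})"
        using nb_inj X by (intro inj_onI) blast
      ultimately have c1: "card {K \<in> on_facets Q v. x \<in> K} = card (X - {x})"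
        by (simp add: card_image)
      have c2: "card {R \<in> horizon Q v. x \<in> R} = card (C - X - {x})"
        using card_hor[of "{x}"] x by simp
      \<comment> \<open>Three neighbours of \<open>T\<close> pass through \<open>x\<close>. Each
        accounts for one facet at the new edge: the extended neighbour if it is chosen, the cone
        over its ridge with \<open>T\<close> otherwise.\<close>
      have "facet_degree ?Q E = card (X - {x}) + card (C - X - {x})"
        using facet_degree_hull_insert_new[OF Q vQ, of x] c1 c2 2 x vertices_in_Q by auto
      also have "\<dots> = card ((X - {x}) \<union> (C - X - {x}))"
        using C X by (intro card_Un_disjoint[symmetric]) (auto intro: finite_subset)
      also have "(X - {x}) \<union> (C - X - {x}) = C - {x}" using X by blast
      also have "card (C - {x}) = 3" using x C by simp
      finally have "facet_degree ?Q E = 3" .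
      \<comment> \<open>Pairs in \<open>B'\<close> lie in the convex set \<open>Q\<close>, so their
        segments miss \<open>v\<close>.\<close>
      moreover have "E \<notin> (hull) convex ` B'"
      proof
        assume "E \<in> (hull) convex ` B'"
        then obtain e where e: "e \<in> B'" "E = convex hull e" by blast
        have "E \<subseteq> Q" using e new[OF e(1)] hull_minimal[of e Q convex] polytope4_convex[OF Q] by blast
        then show False using 2(5) vQ hull_inc[of v "{x, v}" convex] by blast
      qed
      ultimately show ?thesis by simp
    qed
  qed
  moreover have "convex hull (insert v (C - {x})) facet_of ?Q" if "x \<in> C - X" for x
  proof -
    have "convex hull (C - {x}) \<in> horizon Q v" using hor that by blast
    then have "convex hull (insert v (convex hull (C - {x}))) facet_of ?Q"
      using facet_of_hull_insert_iff[OF Q vQ] by blast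
    then show ?thesis by (metis hull_insert)
  qed
  moreover have "convex hull D facet_of ?Q"
    if D: "convex hull D facet_of Q" "finite D" "card D = 4" "X \<subseteq> D" "\<not> D \<subseteq> C" for D
  proof -
    interpret d: simplex_facet_of_polytope Q D
      using Q D by unfold_locales
    have "convex hull D \<noteq> T"
    proof
      assume eq: "convex hull D = T"
      have "x \<in> D \<longleftrightarrow> x \<in> C" for x
        using extreme_point_of_convex_hull_affine_independent[OF d.indep, of x]
          extreme_point_of_convex_hull_affine_independent[OF indep, of x] unfolding eq by simp
      then show False using D(5) by blast
    qed
    moreover have "convex hull D \<notin> ?A"
    proof
      assume "convex hull D \<in> ?A"
      then obtain x where "x \<in> X" "convex hull D = nb x" unfolding A_eq by blast
      then show False using D(4) hull_subset[of D convex] vertex_nb_iff[of x x] X by blast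
    qed
    ultimately have "facet_slack Q (convex hull D) v > 0"
      using sl(3)[OF D(1)] emp by blast
    then show ?thesis using facet_of_hull_insert_iff[OF Q vQ] D(1) by blast
  qed
  ultimately show ?thesis using vQ unfolding stacked_def by blast
qed

section \<open>Placing a point beyond two adjacent simplex facets\<close>

lemma card_filter_doubleton:
  assumes "a \<noteq> b"
  shows "card {x \<in> {a, b}. P x} = (if P a then 1 else 0) + (if P b then 1 else 0)"
proof -
  have "{x \<in> {a, b}. P x} = (if P a then {a} else {}) \<union> (if P b then {b} else {})"
    by auto
  then show ?thesis using assms by auto
qed

lemma card_filter_triple:
  assumes "a \<noteq> b" "a \<noteq> c" "b \<noteq> c"
  shows "card {x \<in> {a, b, c}. P x} = (if P a then 1 else 0) + (if P b then 1 else 0) + (if P c then 1 else 0)"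
proof -
  have "{x \<in> {a, b, c}. P x} = (if P a then {a} else {}) \<union> (if P b then {b} else {}) \<union> (if P c then {c} else {})"
    by auto
  then show ?thesis using assms by auto
qed

text \<open>Needed to recognise an old edge that is no longer an edge: the counting formula then
  returns a number below 2.\<close>

lemma edge_facet_degree_ge_2:
  assumes Q: "polytope4 Q" and E: "E face_of Q" "aff_dim E = 1"
  shows "facet_degree Q E \<ge> 2"
proof -
  have "E \<noteq> {}" "aff_dim E \<le> 2" using E(2) by auto
  then obtain G H where GH: "adjacent_facets Q G H" "E \<subseteq> G \<inter> H"
    using face_in_adjacent_facets[OF Q E(1)] by blast
  note d = adjacent_facetsD[OF GH(1)]
  have "card {G, H} \<le> facet_degree Q E"
    unfolding facet_degree_def
  proof (rule card_mono)
    show "finite {F. F facet_of Q \<and> E \<subseteq> F}"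
      using finite_facets[OF Q] by (rule finite_subset[rotated]) blast
    show "{G, H} \<subseteq> {F. F facet_of Q \<and> E \<subseteq> F}"
      using d(1,2) GH(2) by simp
  qed
  then show ?thesis using d(3) by simp
qed

text \<open>The lost simplices share the triangle \<open>{v2, v3, v4}\<close>, and their union is
  bounded by six triangles. The facet across \<open>{v0, v2, v4}\<close> also lies across
  \<open>{v2, v4, v5}\<close> and is extended, as is the one across \<open>{v0, v2, v3}\<close>; the
  other three triangles form the horizon. A step beyond the first simplex alone with the same chosen
  neighbours would raise \<open>{v3, v4}\<close> to degree 5; here that edge loses two facets and
  gains two.\<close>

lemma double_simplex_step:
  assumes inv: "simple_except Q {{v0, v2}, {v2, v3}, {v3, v4}}"
    and dist: "distinct [v0, v2, v3, v4, v5]"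
    and T: "convex hull {v0, v2, v3, v4} facet_of Q" and U: "convex hull {v2, v3, v4, v5} facet_of Q"
    and v: "v \<in> region Q (convex hull {v0, v2, v3, v4})
       (across Q (convex hull {v0, v2, v3, v4}) {{v0, v2, v4}, {v0, v2, v3}})
       (across Q (convex hull {v0, v2, v3, v4}) {{v2, v3, v4}})"
  shows "v \<notin> Q"
    and "simple_except (convex hull (insert v Q)) {{v3, v4}, {v3, v5}, {v3, v}}"
    and "convex hull {v3, v4, v5, v} facet_of convex hull (insert v Q)"
proof -
  let ?Q = "convex hull (insert v Q)"
  let ?B = "{{v0, v2}, {v2, v3}, {v3, v4}}" and ?B' = "{{v3, v4}, {v3, v5}, {v3, v}}"
  define CT CU where "CT = {v0, v2, v3, v4}" and "CU = {v2, v3, v4, v5}"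
  define T' U' where "T' = convex hull CT" and "U' = convex hull CU"
  have ne: "v0 \<noteq> v2" "v0 \<noteq> v3" "v0 \<noteq> v4" "v0 \<noteq> v5" "v2 \<noteq> v3" "v2 \<noteq> v4" "v2 \<noteq> v5"
    "v3 \<noteq> v4" "v3 \<noteq> v5" "v4 \<noteq> v5" using dist by auto
  note ne = ne ne[symmetric]
  have Q: "polytope4 Q" and ts: "two_simplicial Q" using inv by (auto simp: simple_except_def)
  interpret t: simplex_facet_of_polytope Q CT
    using Q T ne by unfold_locales (auto simp: CT_def)
  interpret u: simplex_facet_of_polytope Q CU
    using Q U ne by unfold_locales (auto simp: CU_def)
  note Tf = t.T[folded T'_def] and Uf = u.T[folded U'_def]
  have inT: "v0 \<in> CT" "v2 \<in> CT" "v3 \<in> CT" "v4 \<in> CT" and inU: "v2 \<in> CU" "v3 \<in> CU" "v4 \<in> CU" "v5 \<in> CU"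
    by (auto simp: CT_def CU_def)
  have vert: "x extreme_point_of Q" if "x \<in> CT \<union> CU" for x
    using that t.face[of "{x}"] u.face[of "{x}"] by (auto simp: face_of_singleton)
  have vertT: "x \<in> CT" if "x extreme_point_of Q" "x \<in> T'" for x
    using that extreme_point_of_face[OF facet_of_imp_face_of[OF Tf]] extreme_point_of_convex_hull
    unfolding T'_def by blast
  have vertU: "x \<in> CU" if "x extreme_point_of Q" "x \<in> U'" for x
    using that extreme_point_of_face[OF facet_of_imp_face_of[OF Uf]] extreme_point_of_convex_hull
    unfolding U'_def by blast
  have "v5 \<notin> CT" "v0 \<notin> CU" using ne by (auto simp: CT_def CU_def)
  then have v5T: "v5 \<notin> T'" and v0U: "v0 \<notin> U'" using vertT vertU vert inT inU by blast+
  have memT: "v0 \<in> T'" "v2 \<in> T'" "v3 \<in> T'" "v4 \<in> T'" and memU: "v2 \<in> U'" "v3 \<in> U'" "v4 \<in> U'" "v5 \<in> U'"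
    unfolding T'_def U'_def using inT inU by (auto intro: hull_inc)
  have TU: "T' \<noteq> U'" using v5T memU by blast

  \<comment> \<open>\<open>F1\<close>, \<open>A1\<close>, \<open>Y\<close> lie across
    \<open>{v0, v2, v4}\<close>, \<open>{v0, v2, v3}\<close>, \<open>{v0, v3, v4}\<close> from
    \<open>T'\<close>; below, \<open>X2\<close>, \<open>X3\<close> lie across
    \<open>{v2, v3, v5}\<close>, \<open>{v3, v4, v5}\<close> from \<open>U'\<close>.\<close>
  define F1 A1 Y where "F1 = t.nb v3" and "A1 = t.nb v4" and "Y = t.nb v2"
  define X2 X3 where "X2 = u.nb v4" and "X3 = u.nb v2"
  have U_nb: "U' = t.nb v0"
    by (rule t.nb_unique[OF inT(1) Uf]) (use TU memU in \<open>auto simp: T'_def CT_def\<close>)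
  have T_nb: "T' = u.nb v5"
    by (rule u.nb_unique[OF inU(4) Tf]) (use TU memT in \<open>auto simp: U'_def CU_def\<close>)
  have adjT: "adjacent_facets Q T' (t.nb x)" if "x \<in> CT" for x using t.nb(1)[OF that] unfolding T'_def .
  have adjU: "adjacent_facets Q U' (u.nb x)" if "x \<in> CU" for x using u.nb(1)[OF that] unfolding U'_def .
  have fac: "F1 facet_of Q" "A1 facet_of Q" "Y facet_of Q" "X2 facet_of Q" "X3 facet_of Q"
    unfolding F1_def A1_def Y_def X2_def X3_def
    using adjacent_facetsD(2)[OF adjT] adjacent_facetsD(2)[OF adjU] inT inU by auto
  have mem: "v0 \<in> F1" "v2 \<in> F1" "v3 \<notin> F1" "v4 \<in> F1" "v0 \<in> A1" "v2 \<in> A1" "v3 \<in> A1" "v4 \<notin> A1"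
    "v0 \<in> Y" "v3 \<in> Y" "v4 \<in> Y" "v2 \<notin> Y"
    "v2 \<in> X2" "v3 \<in> X2" "v5 \<in> X2" "v4 \<notin> X2" "v3 \<in> X3" "v4 \<in> X3" "v5 \<in> X3" "v2 \<notin> X3"
    unfolding F1_def A1_def Y_def X2_def X3_def using t.vertex_nb_iff u.vertex_nb_iff inT inU ne by auto
  have seg: "convex hull {a, b} \<subseteq> G" if "G facet_of Q" "a \<in> G" "b \<in> G" for a b G
    using that face_of_imp_convex[OF facet_of_imp_face_of[OF that(1)]] by (intro hull_minimal) auto
  have edgeT: "convex hull {a, b} face_of Q" "aff_dim (convex hull {a, b}) = 1"
    if "a \<in> CT" "b \<in> CT" "a \<noteq> b" for a b
    using that t.face[of "{a, b}"] t.aff_dim_face[of "{a, b}"] by auto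
  have degT: "facet_degree Q (convex hull {a, b}) = (if {a, b} \<in> ?B then 4 else 3)"
    if "a \<in> CT" "b \<in> CT" "a \<noteq> b" for a b
    using simple_except_degree[OF inv edgeT(1)[OF that] that(3)] .

  \<comment> \<open>The edge from \<open>v2\<close> to \<open>v4\<close> has degree 3, so
    \<open>T'\<close>, \<open>U'\<close> and \<open>F1\<close> are all the facets through it, and
    the neighbour of \<open>U'\<close> omitting \<open>v3\<close> can only be
    \<open>F1\<close>.\<close>
  have F1_nb: "F1 = u.nb v3"
  proof -
    have "{v2, v4} \<notin> ?B" using ne by (auto simp: doubleton_eq_iff)
    then have "facet_degree Q (convex hull {v2, v4}) = 3" using degT[OF inT(2,4)] ne by simp
    moreover have sub: "{T', U', F1} \<subseteq> {F. F facet_of Q \<and> convex hull {v2, v4} \<subseteq> F}"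
      using seg[OF Tf memT(2,4)] seg[OF Uf memU(1,3)] seg[OF fac(1) mem(2,4)] Tf Uf fac(1) by simp
    moreover have "card {T', U', F1} = 3"
    proof -
      have "F1 \<noteq> T'" "F1 \<noteq> U'" using memT memU mem(3) by auto
      then show ?thesis using TU by auto
    qed
    moreover have "finite {F. F facet_of Q \<and> convex hull {v2, v4} \<subseteq> F}"
      using finite_facets[OF Q] by (rule finite_subset[rotated]) auto
    ultimately have eq: "{T', U', F1} = {F. F facet_of Q \<and> convex hull {v2, v4} \<subseteq> F}"
      unfolding facet_degree_def by (intro card_subset_eq) simp_all
    have "u.nb v3 facet_of Q" using adjacent_facetsD(2)[OF adjU[OF inU(2)]] .
    moreover have "v2 \<in> u.nb v3" "v4 \<in> u.nb v3" "v5 \<in> u.nb v3"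
      using u.vertex_nb_iff inU ne by auto
    ultimately have "u.nb v3 \<in> {T', U', F1}" unfolding eq using seg by blast
    moreover have "u.nb v3 \<noteq> T'" using \<open>v5 \<in> u.nb v3\<close> v5T by blast
    moreover have "u.nb v3 \<noteq> U'" using adjacent_facetsD(3)[OF adjU[OF inU(2)]] by simp
    ultimately show ?thesis by simp
  qed
  have v5F1: "v5 \<in> F1" unfolding F1_nb using u.vertex_nb_iff inU ne by auto

  have acr: "across Q T' {{v0, v2, v4}, {v0, v2, v3}} = {F1, A1}" "across Q T' {{v2, v3, v4}} = {U'}"
  proof -
    have "{{v0, v2, v4}, {v0, v2, v3}} = (\<lambda>x. CT - {x}) ` {v3, v4}" "{{v2, v3, v4}} = (\<lambda>x. CT - {x}) ` {v0}"
      using ne by (auto simp: CT_def)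
    then show "across Q T' {{v0, v2, v4}, {v0, v2, v3}} = {F1, A1}" "across Q T' {{v2, v3, v4}} = {U'}"
      using t.across_eq[of "{v3, v4}"] t.across_eq[of "{v0}"] inT
      by (simp_all add: T'_def[symmetric] F1_def A1_def U_nb)
  qed
  have v': "v \<in> region Q T' (across Q T' {{v0, v2, v4}, {v0, v2, v3}}) (across Q T' {{v2, v3, v4}})"
    using v unfolding T'_def CT_def .
  note sl = region_slack[OF Q Tf v', unfolded acr]
  have negT: "facet_slack Q T' v < 0" and negU: "facet_slack Q U' v < 0"
    and zF1: "facet_slack Q F1 v = 0" and zA1: "facet_slack Q A1 v = 0"
    using sl(1)[OF Tf] sl(1)[OF Uf] sl(2)[OF fac(1)] sl(2)[OF fac(2)] by auto
  have pos: "facet_slack Q G v > 0" if "G facet_of Q" "G \<noteq> T'" "G \<noteq> U'" "G \<noteq> F1" "G \<noteq> A1" for G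
    using sl(3)[OF that(1)] that by auto
  have neg_iff: "G = T' \<or> G = U'" if "G facet_of Q" "facet_slack Q G v < 0" for G
    using pos[OF that(1)] that(2) zF1 zA1 by force
  have on_eq: "on_facets Q v = {F1, A1}"
  proof -
    have "G = F1 \<or> G = A1" if "G facet_of Q" "facet_slack Q G v = 0" for G
      using pos[OF that(1)] that(2) negT negU by force
    then show ?thesis using fac zF1 zA1 by (auto simp: on_facets_def)
  qed
  show vQ: "v \<notin> Q" using negT facet_slack_nonneg[OF Q Tf, of v] by linarith
  \<comment> \<open>If they coincided, \<open>T'\<close>, \<open>U'\<close> and \<open>A1\<close>
    would be pairwise adjacent around the edge from \<open>v2\<close> to \<open>v3\<close>, which
    has degree 4.\<close>
  have X2A1: "X2 \<noteq> A1"
  proof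
    assume eq: "X2 = A1"
    have "facet_degree Q (convex hull {v2, v3}) = 3"
    proof (rule three_adjacent_facets_degree[OF Q, of _ T' U' A1])
      show "aff_dim (convex hull {v2, v3}) = 1" using edgeT(2)[OF inT(2,3)] ne by simp
      show "convex hull {v2, v3} \<subseteq> T'" "convex hull {v2, v3} \<subseteq> U'" "convex hull {v2, v3} \<subseteq> A1"
        using seg[OF Tf memT(2,3)] seg[OF Uf memU(1,2)] seg[OF fac(2) mem(6,7)] by auto
      show "adjacent_facets Q T' U'" unfolding U_nb by (rule adjT[OF inT(1)])
      show "adjacent_facets Q U' A1" unfolding eq[symmetric] X2_def by (rule adjU[OF inU(3)])
      show "adjacent_facets Q T' A1" unfolding A1_def by (rule adjT[OF inT(4)])
    qed
    then show False using degT[OF inT(2,3)] ne by simp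
  qed
  have v5A1: "v5 \<notin> A1"
  proof
    assume "v5 \<in> A1"
    then have "CU - {v4} \<subseteq> A1" using mem(6,7) by (auto simp: CU_def)
    moreover have "A1 \<noteq> U'" using mem(8) memU by blast
    ultimately have "A1 = X2"
      unfolding X2_def using u.nb_unique[OF inU(3) fac(2)] by (simp add: U'_def)
    then show False using X2A1 by simp
  qed
  \<comment> \<open>Here the degree 4 of the edge from \<open>v0\<close> to \<open>v2\<close> is
    spent: with \<open>T'\<close> it lies in both \<open>F1\<close> and \<open>A1\<close>.\<close>
  have nadj: "\<not> adjacent_facets Q G H" if GH: "G \<in> on_facets Q v" "H \<in> on_facets Q v" for G H
  proof
    assume adj: "adjacent_facets Q G H"
    have "G \<in> {F1, A1}" "H \<in> {F1, A1}" "G \<noteq> H"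
      using GH adjacent_facetsD(3)[OF adj] unfolding on_eq by auto
    then have adj': "adjacent_facets Q F1 A1"
      using adj by (auto simp: adjacent_facets_def Int_commute)
    have "facet_degree Q (convex hull {v0, v2}) = 3"
    proof (rule three_adjacent_facets_degree[OF Q, of _ T' F1 A1])
      show "aff_dim (convex hull {v0, v2}) = 1" using edgeT(2)[OF inT(1,2)] ne by simp
      show "convex hull {v0, v2} \<subseteq> T'" "convex hull {v0, v2} \<subseteq> F1" "convex hull {v0, v2} \<subseteq> A1"
        using seg[OF Tf memT(1,2)] seg[OF fac(1) mem(1,2)] seg[OF fac(2) mem(5,6)] by auto
      show "adjacent_facets Q T' F1" unfolding F1_def by (rule adjT[OF inT(3)])
      show "adjacent_facets Q F1 A1" by (rule adj')
      show "adjacent_facets Q T' A1" unfolding A1_def by (rule adjT[OF inT(4)])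
    qed
    then show False using degT[OF inT(1,2)] ne by simp
  qed

  define R1 R2 R3 where "R1 = convex hull {v0, v3, v4}" and "R2 = convex hull {v2, v3, v5}"
    and "R3 = convex hull {v3, v4, v5}"
  have Rnb: "T' \<inter> Y = R1" "U' \<inter> X2 = R2" "U' \<inter> X3 = R3"
  proof -
    have "CT - {v2} = {v0, v3, v4}" "CU - {v4} = {v2, v3, v5}" "CU - {v2} = {v3, v4, v5}"
      using ne by (auto simp: CT_def CU_def)
    then show "T' \<inter> Y = R1" "U' \<inter> X2 = R2" "U' \<inter> X3 = R3"
      using t.nb(2)[OF inT(2)] u.nb(2)[OF inU(3)] u.nb(2)[OF inU(1)]
      by (simp_all add: T'_def U'_def Y_def X2_def X3_def R1_def R2_def R3_def)
  qed
  have posYX: "facet_slack Q Y v > 0" "facet_slack Q X2 v > 0" "facet_slack Q X3 v > 0"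
    by (rule pos; use fac mem memT memU v0U v5T X2A1 in blast)+
  have hor: "horizon Q v = {R1, R2, R3}"
  proof (intro equalityI subsetI)
    fix R assume "R \<in> horizon Q v"
    then obtain G H where GH: "R = G \<inter> H" "adjacent_facets Q G H" "facet_slack Q G v > 0" "facet_slack Q H v < 0"
      by (auto simp: horizon_def)
    have adj: "adjacent_facets Q H G" using GH(2) by (auto simp: adjacent_facets_def Int_commute)
    have nG: "G \<noteq> T'" "G \<noteq> U'" "G \<noteq> F1" "G \<noteq> A1" using GH(3) negT negU zF1 zA1 by auto
    from neg_iff[OF adjacent_facetsD(2)[OF GH(2)] GH(4)] show "R \<in> {R1, R2, R3}"
    proof
      assume H: "H = T'"
      obtain x where x: "x \<in> CT" "t.T \<inter> G = convex hull (CT - {x})"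
        using t.adjacent_cases[of G] adj unfolding H T'_def by blast
      have G: "G = t.nb x" using t.adjacent_imp_nb[OF _ x] adj unfolding H T'_def by blast
      have "x = v2" using x(1) nG unfolding G U_nb F1_def A1_def by (auto simp: CT_def)
      then show ?thesis using GH(1) Rnb(1) unfolding H G Y_def by auto
    next
      assume H: "H = U'"
      obtain x where x: "x \<in> CU" "u.T \<inter> G = convex hull (CU - {x})"
        using u.adjacent_cases[of G] adj unfolding H U'_def by blast
      have G: "G = u.nb x" using u.adjacent_imp_nb[OF _ x] adj unfolding H U'_def by blast
      have "x = v2 \<or> x = v4" using x(1) nG unfolding G T_nb F1_nb by (auto simp: CU_def)
      then show ?thesis using GH(1) Rnb(2,3) unfolding H G X2_def X3_def by auto
    qed
  next
    have sym: "adjacent_facets Q G H" if "adjacent_facets Q H G" for G H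
      using that by (auto simp: adjacent_facets_def Int_commute)
    have "R1 \<in> horizon Q v" "R2 \<in> horizon Q v" "R3 \<in> horizon Q v"
      unfolding horizon_def Rnb[symmetric]
      using sym[OF adjT[OF inT(2)]] sym[OF adjU[OF inU(3)]] sym[OF adjU[OF inU(1)]] posYX negT negU
      unfolding Y_def X2_def X3_def by (blast intro: Int_commute)+
    then show "R \<in> horizon Q v" if "R \<in> {R1, R2, R3}" for R using that by blast
  qed
  have memR: "v0 \<in> R1" "v2 \<notin> R1" "v3 \<in> R1" "v4 \<in> R1" "v5 \<notin> R1"
    "v0 \<notin> R2" "v2 \<in> R2" "v3 \<in> R2" "v4 \<notin> R2" "v5 \<in> R2"
    "v0 \<notin> R3" "v2 \<notin> R3" "v3 \<in> R3" "v4 \<in> R3" "v5 \<in> R3"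
    using mem memT memU v0U v5T unfolding Rnb[symmetric] by auto
  have R_ne: "R1 \<noteq> R2" "R1 \<noteq> R3" "R2 \<noteq> R3" using memR by blast+
  have old: "facet_degree ?Q E + ((if E \<subseteq> T' then 1 else 0) + (if E \<subseteq> U' then 1 else 0)) =
      facet_degree Q E + ((if E \<subseteq> R1 then 1 else 0) + (if E \<subseteq> R2 then 1 else 0) + (if E \<subseteq> R3 then 1 else 0))"
    if E: "E \<subseteq> Q" for E
  proof -
    have "{F. F facet_of Q \<and> facet_slack Q F v < 0 \<and> E \<subseteq> F} = {F \<in> {T', U'}. E \<subseteq> F}"
      using neg_iff Tf Uf negT negU by blast
    then have "card {F. F facet_of Q \<and> facet_slack Q F v < 0 \<and> E \<subseteq> F} =
        (if E \<subseteq> T' then 1 else 0) + (if E \<subseteq> U' then 1 else 0)"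
      by (simp only: card_filter_doubleton[OF TU])
    moreover have "card {R \<in> horizon Q v. E \<subseteq> R} =
        (if E \<subseteq> R1 then 1 else 0) + (if E \<subseteq> R2 then 1 else 0) + (if E \<subseteq> R3 then 1 else 0)"
      unfolding hor by (rule card_filter_triple[OF R_ne])
    ultimately show ?thesis using facet_degree_hull_insert_old[OF Q vQ E] by simp
  qed
  have cR: "convex T'" "convex U'" "convex R1" "convex R2" "convex R3"
    by (simp_all add: T'_def U'_def R1_def R2_def R3_def)
  have RTU: "R1 \<subseteq> T'" "R2 \<subseteq> U'" "R3 \<subseteq> U'" using Rnb by blast+
  have pair: "facet_degree ?Q (convex hull {a, b}) +
        ((if a \<in> T' \<and> b \<in> T' then 1 else 0) + (if a \<in> U' \<and> b \<in> U' then 1 else 0)) =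
      (if {a, b} \<in> ?B then 4 else 3) + ((if a \<in> R1 \<and> b \<in> R1 then 1 else 0) +
        (if a \<in> R2 \<and> b \<in> R2 then 1 else 0) + (if a \<in> R3 \<and> b \<in> R3 then 1 else 0))"
    if "convex hull {a, b} face_of Q" "a \<noteq> b" for a b
  proof -
    have "convex hull {a, b} \<subseteq> G \<longleftrightarrow> a \<in> G \<and> b \<in> G" if "convex G" for G
      using subset_hull[of convex G "{a, b}", OF that] by simp
    then show ?thesis
      using old[OF face_of_imp_subset[OF that(1)]] simple_except_degree[OF inv that] cR by simp
  qed
  have QQ: "Q \<subseteq> ?Q" "v \<in> ?Q" by (auto intro: hull_inc)
  note Q' = polytope4_hull_insert[OF Q, of v]
  have vne: "v \<noteq> v0" "v \<noteq> v2" "v \<noteq> v3" "v \<noteq> v4" "v \<noteq> v5"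
    using vQ t.vertices_in_Q u.vertices_in_Q inT inU by auto
  note vne = vne vne[symmetric]
  have card2: "card e = 2" if "e \<in> ?B'" for e
    using that ne vne by auto
  show "simple_except ?Q ?B'"
    unfolding simple_except_def
  proof (intro conjI ballI allI impI)
    show "polytope4 ?Q" by (rule Q')
    show "two_simplicial ?Q" by (rule two_simplicial_hull_insert[OF Q ts nadj])
    show "card e = 2" if "e \<in> ?B'" for e by (rule card2[OF that])
    show "e \<subseteq> ?Q" if "e \<in> ?B'" for e
      using that QQ t.vertices_in_Q u.vertices_in_Q inT inU by auto
    fix E assume "E face_of ?Q \<and> aff_dim E = 1"
    then have E: "E face_of ?Q" "aff_dim E = 1" by auto
    \<comment> \<open>Eliminates the pair \<open>{v2, v4}\<close>: it loses \<open>T'\<close> and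
      \<open>U'\<close> and lies in no horizon ridge, so its count would be 1. This is the destroyed
      edge.\<close>
    note deg2 = edge_facet_degree_ge_2[OF Q' E]
    have "E face_of Q \<or> (\<exists>x H. x extreme_point_of Q \<and> H facet_of Q \<and> facet_slack Q H v < 0 \<and>
        x \<in> H \<and> E = convex hull {x, v})"
      by (rule edge_hull_insert_cases[OF Q vQ _ E]) (rule nadj)
    then consider (old) "E face_of Q" "E \<subseteq> T'" | (old') "E face_of Q" "\<not> E \<subseteq> T'" "E \<subseteq> U'"
      | (far) "E face_of Q" "\<not> E \<subseteq> T'" "\<not> E \<subseteq> U'"
      | (new) x H where "x extreme_point_of Q" "H facet_of Q" "facet_slack Q H v < 0" "x \<in> H"
          "E = convex hull {x, v}" by blast
    then show "facet_degree ?Q E = (if E \<in> (hull) convex ` ?B' then 4 else 3)"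
    proof cases
      case old
      then obtain a b where ab: "a \<in> CT" "b \<in> CT" "a \<noteq> b" "E = convex hull {a, b}"
        using t.edge_cases[OF _ _ E(2)] unfolding T'_def by blast
      have img: "E \<in> (hull) convex ` ?B' \<longleftrightarrow> {a, b} \<in> ?B'"
        unfolding ab(4) by (rule convex_hull_doubleton_image_iff[OF card2 ab(3)])
      note p = pair[OF old(1)[unfolded ab(4)] ab(3), folded ab(4)]
      show ?thesis
        using ab(1-3) p deg2 unfolding img CT_def
        by (elim insertE emptyE) (simp_all add: memR memT memU v0U v5T ne vne doubleton_eq_iff)
    next
      case old'
      then obtain a b where ab: "a \<in> CU" "b \<in> CU" "a \<noteq> b" "E = convex hull {a, b}"
        using u.edge_cases[OF _ _ E(2)] unfolding U'_def by blast
      have img: "E \<in> (hull) convex ` ?B' \<longleftrightarrow> {a, b} \<in> ?B'"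
        unfolding ab(4) by (rule convex_hull_doubleton_image_iff[OF card2 ab(3)])
      note p = pair[OF old'(1)[unfolded ab(4)] ab(3), folded ab(4)]
      have "\<not> (a \<in> T' \<and> b \<in> T')"
        using old'(2) subset_hull[of convex T' "{a, b}", OF cR(1)] unfolding ab(4) by simp
      then show ?thesis
        using ab(1-3) p deg2 unfolding img CU_def
        by (elim insertE emptyE) (simp_all add: memR memT memU v0U v5T ne vne doubleton_eq_iff)
    next
      case far
      have "\<not> E \<subseteq> R1" "\<not> E \<subseteq> R2" "\<not> E \<subseteq> R3" using RTU far by blast+
      then have "facet_degree ?Q E = facet_degree Q E"
        using old[OF face_of_imp_subset[OF far(1)]] far by simp
      moreover have "E \<notin> (hull) convex ` ?B"
        using far(2) seg[OF Tf] memT by blast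
      then have "facet_degree Q E = 3"
        using inv far(1) E(2) by (simp add: simple_except_def)
      moreover have "E \<notin> (hull) convex ` ?B'"
      proof -
        have "E \<noteq> convex hull {v3, v4}" using far(2) seg[OF Tf memT(3,4)] by blast
        moreover have "E \<noteq> convex hull {v3, v5}" using far(3) seg[OF Uf memU(2,4)] by blast
        moreover have "E \<noteq> convex hull {v3, v}"
          using face_of_imp_subset[OF far(1)] vQ hull_inc[of v "{v3, v}" convex] by blast
        ultimately show ?thesis by blast
      qed
      ultimately show ?thesis by simp
    next
      case (new x H)
      have x: "x \<in> {v0, v2, v3, v4, v5}"
        using neg_iff[OF new(2,3)] vertT vertU new(1,4) unfolding CT_def CU_def by blast
      then have xQ: "x \<in> Q" using t.vertices_in_Q u.vertices_in_Q inT inU by blast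
      then have xv: "x \<noteq> v" using vQ by blast
      have "F1 \<noteq> A1" using mem by blast
      then have c1: "card {K \<in> on_facets Q v. x \<in> K} = (if x \<in> F1 then 1 else 0) + (if x \<in> A1 then 1 else 0)"
        unfolding on_eq by (rule card_filter_doubleton)
      have c2: "card {R \<in> horizon Q v. x \<in> R} =
          (if x \<in> R1 then 1 else 0) + (if x \<in> R2 then 1 else 0) + (if x \<in> R3 then 1 else 0)"
        unfolding hor by (rule card_filter_triple[OF R_ne])
      have img: "E \<in> (hull) convex ` ?B' \<longleftrightarrow> {x, v} \<in> ?B'"
        unfolding new(5) by (rule convex_hull_doubleton_image_iff[OF card2 xv])
      have deg: "facet_degree ?Q E = (if x \<in> F1 then 1 else 0) + (if x \<in> A1 then 1 else 0) +
          ((if x \<in> R1 then 1 else 0) + (if x \<in> R2 then 1 else 0) + (if x \<in> R3 then 1 else 0))"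
        unfolding new(5) facet_degree_hull_insert_new[OF Q vQ xQ] c1 c2 ..
      \<comment> \<open>Only \<open>v3\<close> lies in four cone bases, namely \<open>A1\<close>,
        \<open>R1\<close>, \<open>R2\<close>, \<open>R3\<close>; each other vertex lies in three.
        Hence \<open>{v3, v}\<close> joins the list.\<close>
      show ?thesis
        using x unfolding img deg
        by (elim insertE emptyE) (simp_all add: memR mem v5F1 v5A1 ne vne doubleton_eq_iff)
    qed
  qed
  have "convex hull (insert v R3) facet_of ?Q"
    using facet_of_hull_insert_iff[OF Q vQ] hor by blast
  moreover have "convex hull (insert v R3) = convex hull {v3, v4, v5, v}"
    unfolding R3_def hull_insert[symmetric] by (simp add: insert_commute)
  ultimately show "convex hull {v3, v4, v5, v} facet_of ?Q" by simp
qed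

section \<open>The two constructions\<close>

lemma simplex_facet_distinct:
  assumes "polytope4 Q" "convex hull {a, b, c, d} facet_of Q"
  shows "distinct [a, b, c, d]"
proof -
  have "card (set [a, b, c, d]) \<le> length [a, b, c, d]" by (rule card_length)
  then have "card (set [a, b, c, d]) = length [a, b, c, d]"
    using simplex_facet_affine_independent(2)[OF assms(1), of "{a, b, c, d}"] assms(2) by simp
  then show ?thesis by (rule card_distinct)
qed

lemma vertices_subset_facet: "convex hull C facet_of Q \<Longrightarrow> C \<subseteq> Q"
  using facet_of_imp_subset hull_subset[of C convex] by blast

lemma insert_subset_hull_insert: "A \<subseteq> Q \<Longrightarrow> insert v A \<subseteq> convex hull (insert v Q)"
  using hull_subset[of "insert v Q" convex] by blast

text \<open>The exceptional edges form in turn a star at \<open>v3\<close>, the path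
  \<open>v2 v3 v0 v4\<close>, the path \<open>v3 v2 v4 v0\<close> and a star at \<open>v4\<close>.
  The last simplex contains this star, and its chosen neighbours share just the edges of the star in
  pairs, so the list becomes empty.\<close>

lemma I1_two_simple_two_simplicial:
  assumes P: "simple_except P {}" and S: "convex hull {v0, v1, v2, v3} facet_of P"
    and I1: "I1_valid P v0 v1 v2 v3 v4 v5 v6 v7 v8"
  shows "simple_except (I1 P v4 v5 v6 v7 v8) {}"
proof -
  define P1 P2 P3 P4 where "P1 = convex hull (insert v4 P)" and "P2 = convex hull (insert v5 P1)"
    and "P3 = convex hull (insert v6 P2)" and "P4 = convex hull (insert v7 P3)"
  have r: "v4 \<in> region P (convex hull {v0, v1, v2, v3}) (across P (convex hull {v0, v1, v2, v3}) {{v0, v1, v2}}) {}"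
    "v5 \<in> region P1 (convex hull {v0, v1, v3, v4})
      (across P1 (convex hull {v0, v1, v3, v4}) {{v1, v3, v4}, {v0, v1, v3}}) {}"
    "v6 \<in> region P2 (convex hull {v0, v2, v3, v4})
      (across P2 (convex hull {v0, v2, v3, v4}) {{v0, v3, v4}, {v0, v2, v3}}) {}"
    "v7 \<in> region P3 (convex hull {v2, v3, v4, v6})
      (across P3 (convex hull {v2, v3, v4, v6}) {{v2, v3, v4}, {v2, v3, v6}}) {}"
    "v8 \<in> region P4 (convex hull {v0, v2, v4, v6})
      (across P4 (convex hull {v0, v2, v4, v6}) {{v0, v4, v6}, {v2, v4, v6}, {v0, v2, v4}}) {}"
    using I1 unfolding I1_valid_def Let_def P1_def P2_def P3_def P4_def by auto
  have "polytope4 P" using P by (simp add: simple_except_def)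
  then have "distinct [v0, v1, v2, v3]" using simplex_facet_distinct S by blast
  then have d0: "distinct [v0, v1, v2, v3]" "distinct [v3, v2, v1, v0]" by auto
  have in0: "{v0, v1, v2, v3} \<subseteq> P" using vertices_subset_facet[OF S] .

  have s1: "stacked P v4 {v0, v1, v2, v3} {v3} {{v0, v3}, {v1, v3}, {v2, v3}}"
    by (rule simplex_step[OF P S _ _ _ _ r(1)]) (use d0 in \<open>simp_all add: doubleton_eq_iff insert_Diff_if\<close>)
  then have B1: "v4 \<notin> P" "simple_except P1 {{v0, v3}, {v1, v3}, {v2, v3}}"
    unfolding stacked_def P1_def by blast+
  have in1: "{v4, v0, v1, v2, v3} \<subseteq> P1" unfolding P1_def by (rule insert_subset_hull_insert[OF in0])
  have d1: "distinct [v0, v1, v2, v3, v4]" "distinct [v4, v3, v2, v1, v0]"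
    using d0 in0 B1(1) by auto
  have f1: "convex hull {v0, v1, v3, v4} facet_of P1" "convex hull {v0, v2, v3, v4} facet_of P1"
    unfolding P1_def by (rule stacked_new_facet[OF s1, of v2], use d1 in auto)
      (rule stacked_new_facet[OF s1, of v1], use d1 in auto)

  have s2: "stacked P1 v5 {v0, v1, v3, v4} {v0, v4} {{v0, v3}, {v2, v3}, {v0, v4}}"
    by (rule simplex_step[OF B1(2) f1(1) _ _ _ _ r(2)]) (use d1 in \<open>simp_all add: doubleton_eq_iff insert_Diff_if\<close>)
  then have B2: "v5 \<notin> P1" "simple_except P2 {{v0, v3}, {v2, v3}, {v0, v4}}"
    unfolding stacked_def P2_def by blast+
  have in2: "{v5, v4, v0, v1, v2, v3} \<subseteq> P2" unfolding P2_def by (rule insert_subset_hull_insert[OF in1])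
  \<comment> \<open>This facet was created by the first step; it survives because it contains both
    omitted vertices \<open>v0\<close> and \<open>v4\<close>, and also \<open>v2\<close>, which is
    not in the current simplex.\<close>
  have f2: "convex hull {v0, v2, v3, v4} facet_of P2"
    unfolding P2_def by (rule stacked_old_facet[OF s2 f1(2)]) (use d1 in simp_all)

  have s3: "stacked P2 v6 {v0, v2, v3, v4} {v2, v4} {{v2, v3}, {v0, v4}, {v2, v4}}"
    by (rule simplex_step[OF B2(2) f2 _ _ _ _ r(3)]) (use d1 in \<open>simp_all add: doubleton_eq_iff insert_Diff_if\<close>)
  then have B3: "v6 \<notin> P2" "simple_except P3 {{v2, v3}, {v0, v4}, {v2, v4}}"
    unfolding stacked_def P3_def by blast+
  have d3: "distinct [v0, v2, v3, v4, v6]" "distinct [v6, v4, v3, v2, v0]"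
    using d1 in2 B3(1) by auto
  have f3: "convex hull {v2, v3, v4, v6} facet_of P3" "convex hull {v0, v2, v4, v6} facet_of P3"
    unfolding P3_def by (rule stacked_new_facet[OF s3, of v0], use d3 in auto)
      (rule stacked_new_facet[OF s3, of v3], use d3 in auto)

  have s4: "stacked P3 v7 {v2, v3, v4, v6} {v6, v4} {{v0, v4}, {v2, v4}, {v4, v6}}"
    by (rule simplex_step[OF B3(2) f3(1) _ _ _ _ r(4)]) (use d3 in \<open>simp_all add: doubleton_eq_iff insert_Diff_if\<close>)
  then have B4: "simple_except P4 {{v0, v4}, {v2, v4}, {v4, v6}}"
    unfolding stacked_def P4_def by blast
  have f4: "convex hull {v0, v2, v4, v6} facet_of P4"
    unfolding P4_def by (rule stacked_old_facet[OF s4 f3(2)]) (use d3 in simp_all)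

  have "stacked P4 v8 {v0, v2, v4, v6} {v2, v0, v6} {}"
    by (rule simplex_step[OF B4 f4 _ _ _ _ r(5)])
      (use d3 in \<open>simp_all add: doubleton_eq_iff insert_Diff_if, blast\<close>)
  then have "simple_except (convex hull (insert v8 P4)) {}"
    unfolding stacked_def by blast
  then show ?thesis
    unfolding I1_def P4_def P3_def P2_def P1_def .
qed

text \<open>The exceptional edges form in turn a star at \<open>v2\<close>, the path
  \<open>v0 v2 v3 v4\<close> and, after the step beyond two facets, a star at \<open>v3\<close> with
  ends \<open>v4\<close>, \<open>v5\<close>, \<open>v6\<close>, which the last step clears.\<close>

lemma I2_two_simple_two_simplicial:
  assumes P: "simple_except P {}" and S: "convex hull {v0, v1, v2, v3} facet_of P"
    and I2: "I2_valid P v0 v1 v2 v3 v4 v5 v6 v7"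
  shows "simple_except (I2 P v4 v5 v6 v7) {}"
proof -
  define Q1 Q2 Q3 where "Q1 = convex hull (insert v4 P)" and "Q2 = convex hull (insert v5 Q1)"
    and "Q3 = convex hull (insert v6 Q2)"
  have r: "v4 \<in> region P (convex hull {v0, v1, v2, v3}) (across P (convex hull {v0, v1, v2, v3}) {{v0, v1, v3}}) {}"
    "v5 \<in> region Q1 (convex hull {v1, v2, v3, v4})
      (across Q1 (convex hull {v1, v2, v3, v4}) {{v1, v2, v4}, {v1, v2, v3}}) {}"
    "v6 \<in> region Q2 (convex hull {v0, v2, v3, v4})
      (across Q2 (convex hull {v0, v2, v3, v4}) {{v0, v2, v4}, {v0, v2, v3}})
      (across Q2 (convex hull {v0, v2, v3, v4}) {{v2, v3, v4}})"
    "v7 \<in> region Q3 (convex hull {v3, v4, v5, v6})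
      (across Q3 (convex hull {v3, v4, v5, v6}) {{v3, v4, v6}, {v3, v4, v5}, {v3, v5, v6}}) {}"
    using I2 unfolding I2_valid_def Let_def Q1_def Q2_def Q3_def by auto
  have "polytope4 P" using P by (simp add: simple_except_def)
  then have "distinct [v0, v1, v2, v3]" using simplex_facet_distinct S by blast
  then have d0: "distinct [v0, v1, v2, v3]" "distinct [v3, v2, v1, v0]" by auto
  have in0: "{v0, v1, v2, v3} \<subseteq> P" using vertices_subset_facet[OF S] .

  have s1: "stacked P v4 {v0, v1, v2, v3} {v2} {{v0, v2}, {v1, v2}, {v2, v3}}"
    by (rule simplex_step[OF P S _ _ _ _ r(1)]) (use d0 in \<open>simp_all add: doubleton_eq_iff insert_Diff_if\<close>)
  then have B1: "v4 \<notin> P" "simple_except Q1 {{v0, v2}, {v1, v2}, {v2, v3}}"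
    unfolding stacked_def Q1_def by blast+
  have in1: "{v4, v0, v1, v2, v3} \<subseteq> Q1" unfolding Q1_def by (rule insert_subset_hull_insert[OF in0])
  have d1: "distinct [v0, v1, v2, v3, v4]" "distinct [v4, v3, v2, v1, v0]"
    using d0 in0 B1(1) by auto
  have f1: "convex hull {v1, v2, v3, v4} facet_of Q1" "convex hull {v0, v2, v3, v4} facet_of Q1"
    unfolding Q1_def by (rule stacked_new_facet[OF s1, of v0], use d1 in auto)
      (rule stacked_new_facet[OF s1, of v1], use d1 in auto)

  have s2: "stacked Q1 v5 {v1, v2, v3, v4} {v3, v4} {{v0, v2}, {v2, v3}, {v3, v4}}"
    by (rule simplex_step[OF B1(2) f1(1) _ _ _ _ r(2)]) (use d1 in \<open>simp_all add: doubleton_eq_iff insert_Diff_if\<close>)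
  then have B2: "v5 \<notin> Q1" "simple_except Q2 {{v0, v2}, {v2, v3}, {v3, v4}}"
    unfolding stacked_def Q2_def by blast+
  have in2: "{v5, v4, v0, v1, v2, v3} \<subseteq> Q2" unfolding Q2_def by (rule insert_subset_hull_insert[OF in1])
  have d2: "distinct [v0, v1, v2, v3, v4, v5]" "distinct [v5, v4, v3, v2, v1, v0]"
    using d1 in1 B2(1) by auto
  \<comment> \<open>One simplex survives from the first step, the other is a cone just created; they
    share the triangle \<open>{v2, v3, v4}\<close>, as the double step requires.\<close>
  have f2: "convex hull {v0, v2, v3, v4} facet_of Q2" "convex hull {v2, v3, v4, v5} facet_of Q2"
    unfolding Q2_def by (rule stacked_old_facet[OF s2 f1(2)], use d1 in simp_all)
      (rule stacked_new_facet[OF s2, of v1], use d2 in auto)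

  have "distinct [v0, v2, v3, v4, v5]" using d2 by auto
  note s3 = double_simplex_step[OF B2(2) this f2 r(3), folded Q3_def]
  have d3: "distinct [v3, v4, v5, v6]" "distinct [v6, v5, v4, v3]"
    using d2 in2 s3(1) by auto

  have "stacked Q3 v7 {v3, v4, v5, v6} {v5, v6, v4} {}"
    by (rule simplex_step[OF s3(2,3) _ _ _ _ r(4)]) (use d3 in \<open>simp_all add: doubleton_eq_iff insert_Diff_if\<close>)
  then have "simple_except (convex hull (insert v7 Q3)) {}"
    unfolding stacked_def by blast
  then show ?thesis
    unfolding I2_def Q3_def Q2_def Q1_def .
qed

theorem theorem3p9:
  fixes P :: "pt set" and v0 v1 v2 v3 :: pt
  assumes "polytope4 P" and "two_simple P" and "two_simplicial P"
    and "bounded_position P (convex hull {v0, v1, v2, v3})"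
  shows "(\<forall>v4 v5 v6 v7 v8. I1_valid P v0 v1 v2 v3 v4 v5 v6 v7 v8 \<longrightarrow>
            (let R = I1 P v4 v5 v6 v7 v8 in polytope4 R \<and> two_simple R \<and> two_simplicial R))
       \<and> (\<forall>v4 v5 v6 v7. I2_valid P v0 v1 v2 v3 v4 v5 v6 v7 \<longrightarrow>
            (let R = I2 P v4 v5 v6 v7 in polytope4 R \<and> two_simple R \<and> two_simplicial R))"
proof -
  have P: "simple_except P {}"
    using assms(1-3) simple_except_iff_two_simple by blast
  have S: "convex hull {v0, v1, v2, v3} facet_of P"
    using assms(4) by (simp add: bounded_position_def simplex_facet_def)
  show ?thesis
    using I1_two_simple_two_simplicial[OF P S] I2_two_simple_two_simplicial[OF P S]
    unfolding Let_def simple_except_iff_two_simple by blast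
qed

end
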